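(* For any infinite abelian group $G$ and any integer $h\geq 2$, $h+1\leq S_G(h)\leq 2h$.
   Context: For $A\subset G$ and a positive integer $h$, $hA$ is the set of sums of $h$ not necessarily distinct elements of $A$; $A\sim B$ means finite symmetric difference. $\operatorname{ord}^*_G(A)$ is the least $k$ with $kA\sim G$ ($\infty$ if none). $S_G(h)$ is the minimum value of $s$ such that for every $A\subset G$ with $hA\sim G$, there are only finitely many $a\in A$ with $\operatorname{ord}^*_G(A\setminus\{a\})>s$ (and $S_G(h)=\infty$ if no such $s$ exists). *)

theory Defs
  imports Main "HOL-Library.Extended_Nat"
begin

definition nsumset :: "nat \<Rightarrow> 'a::ab_group_add set \<Rightarrow> 'a set" where
  "nsumset h A = {x. \<exists>f. (\<forall>i<h. f i \<in> A) \<and> x = (\<Sum>i<h. f i)}"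

definition almost_eq :: "'a set \<Rightarrow> 'a set \<Rightarrow> bool" (infix "\<sim>\<^sup>*" 50) where
  "A \<sim>\<^sup>* B \<longleftrightarrow> finite (sym_diff A B)"

text \<open>In \<^typ>\<open>enat\<close> the infimum of a nonempty set is its least element and the infimum of
  the empty set is \<open>\<infinity>\<close>, as required in the next two definitions. The ambient group is
  the whole type.\<close>

definition ord_star :: "'a::ab_group_add set \<Rightarrow> enat" where
  "ord_star A = Inf {enat k | k. 1 \<le> k \<and> nsumset k A \<sim>\<^sup>* UNIV}"

definition S_fun :: "'a::ab_group_add itself \<Rightarrow> nat \<Rightarrow> enat" where
  "S_fun G h = Inf {enat s | s. \<forall>A :: 'a set. nsumset h A \<sim>\<^sup>* UNIV
     \<longrightarrow> finite {a \<in> A. ord_star (A - {a}) > enat s}}"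

end

theory Submission
  imports Defs "HOL-Library.Multiset" "HOL-Library.Countable_Set" "HOL-Library.FuncSet"
begin

text \<open>Upper bound: fix for each \<open>y\<close> in \<open>hA\<close> one representation and let \<open>E a\<close> be the set of those \<open>y\<close> whose
  representation uses \<open>a\<close>; each \<open>y\<close> lies in at most \<open>h\<close> of these sets.  If \<open>x\<close> is not a sum of \<open>2h\<close> elements
  of \<open>A - {a}\<close>, then \<open>E a\<close> and \<open>x - E a\<close> cover the group up to a finite set, so \<open>E a\<close> has mean at least
  one half; hence there are at most \<open>2h\<close> such \<open>a\<close>.  Averaging over finite boxes replaces an invariant mean.

  Lower bound: there is a countably infinite quotient \<open>G/K\<close> in which multiplication by each \<open>m \<le> h\<close> either
  vanishes or has infinite image.  In it a greedy construction yields a basis of order \<open>h\<close> and infinitely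
  many special elements \<open>a\<close>, each with infinitely many \<open>x\<close> all of whose representations use \<open>a\<close>, while every
  class also has a representation with a non-special summand.  Lift the special elements to single elements
  and all other ones to full cosets of \<open>K\<close>.\<close>

section \<open>Natural multiples and representations by multisets\<close>

primrec nmult :: "nat \<Rightarrow> 'a::ab_group_add \<Rightarrow> 'a" (infixr "\<cdot>" 75) where
  "0 \<cdot> x = 0"
| "Suc n \<cdot> x = x + n \<cdot> x"

lemma nmult_zero_right [simp]: "n \<cdot> (0::'a::ab_group_add) = 0"
  by (induction n) auto

lemma nmult_one [simp]: "1 \<cdot> x = x" "Suc 0 \<cdot> x = x"
  by auto

lemma nmult_add_left: "(m + n) \<cdot> x = m \<cdot> x + n \<cdot> x"
  by (induction m) (auto simp: algebra_simps)

lemma nmult_add: "n \<cdot> (x + y) = n \<cdot> x + n \<cdot> y"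
  by (induction n) (auto simp: algebra_simps)

lemma nmult_diff: "n \<cdot> (x - y) = n \<cdot> x - n \<cdot> y"
  by (induction n) (auto simp: algebra_simps)

lemma nmult_diff_left: "m \<le> n \<Longrightarrow> (n - m) \<cdot> x = n \<cdot> x - m \<cdot> x"
  using nmult_add_left[of "n - m" m x] by (simp add: algebra_simps)

lemma nmult_mult: "(m * n) \<cdot> x = m \<cdot> n \<cdot> x"
  by (induction m) (auto simp: nmult_add_left)

lemma nmult_sum: "n \<cdot> (\<Sum>i\<in>I. f i) = (\<Sum>i\<in>I. n \<cdot> f i)"
  by (induction n) (auto simp: sum.distrib)

text \<open>Representations as multisets can be added, split and have single summands exchanged,
  without any ordering of the terms.\<close>

lemma mem_nsumset_iff:
  "x \<in> nsumset h A \<longleftrightarrow> (\<exists>M. size M = h \<and> set_mset M \<subseteq> A \<and> x = sum_mset M)"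
proof
  assume "x \<in> nsumset h A"
  then obtain f where f: "\<forall>i<h. f i \<in> A" "x = (\<Sum>i<h. f i)"
    unfolding nsumset_def by auto
  show "\<exists>M. size M = h \<and> set_mset M \<subseteq> A \<and> x = sum_mset M"
    by (rule exI[of _ "image_mset f (mset_set {..<h})"]) (use f in \<open>auto simp: sum_unfold_sum_mset\<close>)
next
  assume "\<exists>M. size M = h \<and> set_mset M \<subseteq> A \<and> x = sum_mset M"
  then obtain M where M: "size M = h" "set_mset M \<subseteq> A" "x = sum_mset M" by auto
  obtain xs where xs: "mset xs = M" using ex_mset by blast
  have "x = (\<Sum>i<h. xs ! i)"
    using M xs by (auto simp: sum_mset_sum_list sum_list_sum_nth atLeast0LessThan)
  moreover have "\<forall>i<h. xs ! i \<in> A" using M xs by (metis nth_mem set_mset_mset size_mset subsetD)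
  ultimately show "x \<in> nsumset h A" unfolding nsumset_def by auto
qed

lemma card_mem_mset_le: "card {a \<in> T. a \<in># M} \<le> size M"
proof -
  have "card {a \<in> T. a \<in># M} \<le> card (set_mset M)" by (rule card_mono) auto
  also have "\<dots> \<le> size M"
    by (induction M) (auto simp: card_insert_if)
  finally show ?thesis .
qed

section \<open>The upper bound\<close>

text \<open>Count the points of a large box of combinations of the \<open>x i\<close>.  The reflection \<open>y \<mapsto> x i - y\<close> maps
  the box translated by \<open>u\<close> to one translated by \<open>- u - c\<close> up to its boundary, and a generic \<open>u\<close> keeps
  both away from \<open>D\<close>.\<close>

lemma card_le_of_reflection_cover:
  fixes x :: "'b \<Rightarrow> 'a::ab_group_add"
  assumes inf: "infinite (UNIV :: 'a set)" and finT: "finite T" and finD: "finite D"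
    and cover: "\<And>i y. i \<in> T \<Longrightarrow> y \<notin> D \<Longrightarrow> x i - y \<notin> D \<Longrightarrow> y \<in> E i \<or> x i - y \<in> E i"
    and mult: "\<And>y. card {i \<in> T. y \<in> E i} \<le> h"
  shows "card T \<le> 2 * h"
proof (rule ccontr)
  assume "\<not> card T \<le> 2 * h"
  then have n: "card T \<ge> 2 * h + 1" by simp
  \<comment> \<open>With side length \<open>M + 1\<close> and \<open>M = card T\<close>, the
    \<open>card T\<close> boundary faces together have fewer points than the box.\<close>
  define M where "M = card T"
  define box where "box = (\<Pi>\<^sub>E i\<in>T. {..M})"
  define p where "p f = (\<Sum>i\<in>T. f i \<cdot> x i)" for f :: "'b \<Rightarrow> nat"
  define c where "c = (\<Sum>i\<in>T. M \<cdot> x i)"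
  have finbox: "finite box" unfolding box_def by (intro finite_PiE) (auto simp: finT)
  \<comment> \<open>Translations \<open>u\<close> for which some point of the box or one of its
    reflections falls into \<open>D\<close>.\<close>
  define bad where "bad = (\<lambda>(d,f). d - p f) ` (D \<times> box) \<union> (\<lambda>(i,d,f). x i - p f - d) ` (T \<times> D \<times> box)"
  have "finite bad" unfolding bad_def using finT finD finbox by auto
  then obtain u where u: "u \<notin> bad" using inf by (metis ex_new_if_finite)
  have u1: "u + p f \<notin> D" if "f \<in> box" for f
  proof
    assume "u + p f \<in> D"
    then have "(\<lambda>(d,f). d - p f) (u + p f, f) \<in> bad" unfolding bad_def using that by blast
    then show False using u by simp
  qed
  have u2: "x i - (u + p f) \<notin> D" if "f \<in> box" "i \<in> T" for f i
  proof
    assume "x i - (u + p f) \<in> D"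
    then have "(\<lambda>(i,d,f). x i - p f - d) (i, x i - (u + p f), f) \<in> bad"
      unfolding bad_def using that by blast
    then show False using u by simp
  qed
  define As where "As i = {f \<in> box. u + p f \<in> E i}" for i
  define Bs where "Bs i = {f \<in> box. - u - c + p f \<in> E i}" for i
  define Cs where "Cs i = {f \<in> box. f i = 0}" for i
  have count: "card box \<le> card (As i) + card (Bs i) + card (Cs i)" if i: "i \<in> T" for i
  proof -
    \<comment> \<open>Reversing all coordinates and adding one in direction \<open>i\<close> turns
      the reflection at \<open>x i\<close> into a map between the two translates. Only points with
      \<open>f i = 0\<close> leave the box, since there the new coordinate is
      \<open>M + 1\<close>.\<close>
    define r where "r f = (\<lambda>j\<in>T. M - f j + (if j = i then 1 else 0))" for f :: "'b \<Rightarrow> nat"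
    have inj: "inj_on r box"
    proof (rule inj_onI)
      fix f g assume fg: "f \<in> box" "g \<in> box" "r f = r g"
      show "f = g"
      proof (rule PiE_ext[OF fg(1,2)[unfolded box_def]])
        fix j assume j: "j \<in> T"
        have "r f j = r g j" using fg by simp
        then have "M - f j = M - g j" using j by (simp add: r_def split: if_splits)
        moreover have "f j \<le> M" "g j \<le> M" using fg j by (auto simp: box_def PiE_def Pi_def)
        ultimately show "f j = g j" by simp
      qed
    qed
    have le: "f j \<le> M" if "f \<in> box" "j \<in> T" for f j using that by (auto simp: box_def PiE_def Pi_def)
    have rp: "x i - (u + p f) = - u - c + p (r f)" if f: "f \<in> box" for f
    proof -
      have "p (r f) = (\<Sum>j\<in>T. M \<cdot> x j - f j \<cdot> x j + (if j = i then x j else 0))"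
        unfolding p_def
      proof (intro sum.cong refl)
        fix j assume j: "j \<in> T"
        have "r f j \<cdot> x j = (M - f j) \<cdot> x j + (if j = i then 1 else 0) \<cdot> x j"
          using j by (simp only: r_def restrict_apply' nmult_add_left)
        then show "r f j \<cdot> x j = M \<cdot> x j - f j \<cdot> x j + (if j = i then x j else 0)"
          using le[OF f j] by (simp add: nmult_diff_left)
      qed
      also have "\<dots> = c - p f + x i"
        using i by (simp add: sum.distrib sum_subtractf c_def p_def finT)
      finally show ?thesis by (simp add: algebra_simps)
    qed
    have "f \<in> As i \<union> Cs i \<union> {f \<in> box. r f \<in> Bs i}" if f: "f \<in> box" for f
    proof (cases "f i = 0")
      case True then show ?thesis using f by (auto simp: Cs_def)
    next
      case False
      have "M - f j + (if j = i then 1 else 0) \<le> M" if "j \<in> T" for j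
        using le[OF f that] False by (cases "j = i") auto
      then have "r f \<in> box" by (auto simp: box_def r_def)
      then show ?thesis
        using cover[OF i u1[OF f] u2[OF f i]] f by (auto simp: As_def Bs_def rp)
    qed
    then have "box \<subseteq> As i \<union> Cs i \<union> {f \<in> box. r f \<in> Bs i}" by blast
    then have "card box \<le> card (As i \<union> Cs i \<union> {f \<in> box. r f \<in> Bs i})"
      by (rule card_mono[rotated]) (auto simp: As_def Cs_def finbox)
    also have "\<dots> \<le> card (As i) + card (Cs i) + card {f \<in> box. r f \<in> Bs i}"
      by (meson add_mono card_Un_le order.refl order.trans)
    also have "card {f \<in> box. r f \<in> Bs i} \<le> card (Bs i)"
      by (rule card_inj_on_le[where f = r])
         (auto simp: Bs_def finbox intro: inj_on_subset[OF inj])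
    finally show ?thesis by simp
  qed
  \<comment> \<open>Double counting with an arbitrary map \<open>q\<close>, so that it serves both
    translates.\<close>
  have sumle: "(\<Sum>i\<in>T. card {f \<in> box. q f \<in> E i}) \<le> h * card box" for q :: "('b \<Rightarrow> nat) \<Rightarrow> 'a"
  proof -
    have "(\<Sum>i\<in>T. card {f \<in> box. q f \<in> E i}) = (\<Sum>i\<in>T. \<Sum>f\<in>box. if q f \<in> E i then 1 else 0)"
      by (simp add: sum.If_cases finbox Int_def)
    also have "\<dots> = (\<Sum>f\<in>box. \<Sum>i\<in>T. if q f \<in> E i then 1 else 0)" by (rule sum.swap)
    also have "\<dots> = (\<Sum>f\<in>box. card {i \<in> T. q f \<in> E i})"
      by (simp add: sum.If_cases finT Int_def)
    also have "\<dots> \<le> (\<Sum>f\<in>box. h)" by (intro sum_mono mult)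
    finally show ?thesis by (simp add: mult.commute)
  qed
  define N where "N = (M + 1) ^ (card T - 1)"
  have cardbox: "card box = (M + 1) * N"
    using n finT unfolding box_def N_def by (cases "T = {}") (simp_all add: card_PiE finT power_eq_if[of _ "card T"])
  have cardC: "card (Cs i) = N" if i: "i \<in> T" for i
  proof -
    have "Cs i = (\<Pi>\<^sub>E j\<in>T. if j = i then {0} else {..M})"
    proof (intro set_eqI iffI)
      fix f assume "f \<in> Cs i"
      then have f: "f \<in> extensional T" "f i = 0" "\<And>j. j \<in> T \<Longrightarrow> f j \<in> {..M}"
        by (auto simp: Cs_def box_def PiE_iff)
      show "f \<in> (\<Pi>\<^sub>E j\<in>T. if j = i then {0} else {..M})"
        unfolding PiE_iff using f by simp
    next
      fix f assume f: "f \<in> (\<Pi>\<^sub>E j\<in>T. if j = i then {0} else {..M})"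
      have "f j \<in> {..M}" if "j \<in> T" for j
        using PiE_mem[OF f that] by (cases "j = i") auto
      moreover have "f i = 0" using PiE_mem[OF f i] by simp
      moreover have "f \<in> extensional T" using f unfolding PiE_iff by blast
      ultimately show "f \<in> Cs i" unfolding Cs_def box_def PiE_iff by blast
    qed
    then have "card (Cs i) = (\<Prod>j\<in>T. if j = i then 1 else M + 1)"
      by (simp add: card_PiE finT if_distrib cong: if_cong)
    also have "\<dots> = (\<Prod>j\<in>T - {i}. M + 1)"
      by (subst prod.remove[OF finT i]) (auto intro!: prod.cong)
    also have "\<dots> = N" using i finT by (simp add: N_def)
    finally show ?thesis .
  qed
  have "card T * card box \<le> (\<Sum>i\<in>T. card (As i) + card (Bs i) + card (Cs i))"
    using sum_mono[OF count, of T] by simp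
  also have "\<dots> = (\<Sum>i\<in>T. card (As i)) + (\<Sum>i\<in>T. card (Bs i)) + card T * N"
    by (simp add: sum.distrib cardC)
  also have "\<dots> \<le> h * card box + h * card box + card T * N"
    unfolding As_def Bs_def by (intro add_mono sumle order.refl)
  finally have main: "card T * card box \<le> 2 * h * card box + M * N"
    by (simp add: M_def)
  have "(2 * h + 1) * card box \<le> card T * card box" using n by (intro mult_right_mono) auto
  then have "card box \<le> M * N" using main by simp
  then show False unfolding cardbox by (simp add: N_def)
qed

text \<open>Takes \<open>2 * h + 1\<close> exceptional elements, one more than the reflection
  argument permits.\<close>

lemma finite_large_ord_star:
  fixes A :: "'a::ab_group_add set"
  assumes inf: "infinite (UNIV :: 'a set)" and h: "h \<ge> 1" and basis: "nsumset h A \<sim>\<^sup>* UNIV"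
  shows "finite {a \<in> A. ord_star (A - {a}) > enat (2 * h)}"
proof (rule ccontr)
  assume "infinite {a \<in> A. ord_star (A - {a}) > enat (2 * h)}"
  then obtain T where T: "T \<subseteq> {a \<in> A. ord_star (A - {a}) > enat (2 * h)}"
    "finite T" "card T = 2 * h + 1"
    using infinite_arbitrarily_large[of _ "2 * h + 1"] by blast
  define D where "D = - nsumset h A"
  have finD: "finite D" using basis by (simp add: almost_eq_def D_def Compl_eq_Diff_UNIV Un_commute)
  \<comment> \<open>A sumset equal to the whole group would bound the order by \<open>2 * h\<close>;
    a single missed point \<open>x a\<close> is enough for the reflection argument.\<close>
  have "\<exists>x. x \<notin> nsumset (2 * h) (A - {a})" if "a \<in> T" for a
  proof (rule ccontr)
    assume "\<nexists>x. x \<notin> nsumset (2 * h) (A - {a})"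
    then have "nsumset (2 * h) (A - {a}) = UNIV" by blast
    then have "ord_star (A - {a}) \<le> enat (2 * h)"
      unfolding ord_star_def by (intro Inf_lower) (use h in \<open>auto simp: almost_eq_def\<close>)
    then show False using T that by auto
  qed
  then obtain x where x: "\<And>a. a \<in> T \<Longrightarrow> x a \<notin> nsumset (2 * h) (A - {a})" by metis
  have "\<forall>y. \<exists>M. y \<notin> D \<longrightarrow> size M = h \<and> set_mset M \<subseteq> A \<and> y = sum_mset M"
    by (auto simp: D_def mem_nsumset_iff)
  then obtain R where R: "\<And>y. y \<notin> D \<Longrightarrow> size (R y) = h \<and> set_mset (R y) \<subseteq> A \<and> y = sum_mset (R y)"
    by metis
  define E where "E a = {y. y \<notin> D \<and> a \<in># R y}" for a
  have "card T \<le> 2 * h"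
  proof (rule card_le_of_reflection_cover[OF inf T(2) finD, of x E])
    fix a y assume a: "a \<in> T" and y: "y \<notin> D" "x a - y \<notin> D"
    show "y \<in> E a \<or> x a - y \<in> E a"
    proof (rule ccontr)
      assume "\<not> ?thesis"
      then have na: "a \<notin># R y" "a \<notin># R (x a - y)" using y by (auto simp: E_def)
      have "x a = sum_mset (R y + R (x a - y))"
        using R[OF y(1)] R[OF y(2)] by (metis add_diff_cancel_left' diff_add_cancel add.commute sum_mset.union)
      moreover have "size (R y + R (x a - y)) = 2 * h" using R[OF y(1)] R[OF y(2)] by simp
      moreover have "set_mset (R y + R (x a - y)) \<subseteq> A - {a}"
        using R[OF y(1)] R[OF y(2)] na by auto
      ultimately show False using x[OF a] unfolding mem_nsumset_iff by blast
    qed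
  next
    fix y
    show "card {i \<in> T. y \<in> E i} \<le> h"
    proof (cases "y \<in> D")
      case False
      then show ?thesis using card_mem_mset_le[of T "R y"] R[OF False] by (simp add: E_def)
    qed (simp add: E_def)
  qed
  then show False using T by simp
qed

section \<open>Countable quotients\<close>

text \<open>The quotient by \<open>K\<close> is never formed as a type: congruence of
  \<open>x\<close> and \<open>y\<close> is the statement \<open>x - y \<in> K\<close>.\<close>

definition add_subgroup :: "'a::ab_group_add set \<Rightarrow> bool" where
  "add_subgroup K \<longleftrightarrow> 0 \<in> K \<and> (\<forall>x\<in>K. \<forall>y\<in>K. x - y \<in> K)"

definition infinite_index :: "'a::ab_group_add set \<Rightarrow> bool" where
  "infinite_index K \<longleftrightarrow> (\<forall>F. finite F \<longrightarrow> (\<exists>z. \<forall>f\<in>F. z - f \<notin> K))"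

text \<open>Formulated for subsets \<open>S\<close>, so that torsion parts and fibres of
  multiplication maps can be counted separately.\<close>

definition countable_mod :: "'a::ab_group_add set \<Rightarrow> 'a set \<Rightarrow> bool" where
  "countable_mod K S \<longleftrightarrow> (\<exists>R. countable R \<and> (\<forall>s\<in>S. \<exists>r\<in>R. s - r \<in> K))"

lemma countable_mod_mono:
  assumes "countable_mod K S" "K \<subseteq> K'" "S' \<subseteq> S"
  shows "countable_mod K' S'"
proof -
  obtain R where "countable R" "\<forall>s\<in>S. \<exists>r\<in>R. s - r \<in> K"
    using assms(1) unfolding countable_mod_def by auto
  then show ?thesis unfolding countable_mod_def using assms(2,3) by (intro exI[of _ R]) (meson subsetD)
qed

context
  fixes K :: "'a::ab_group_add set"
  assumes K: "add_subgroup K"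
begin

lemma add_subgroup_zero: "0 \<in> K"
  and add_subgroup_diff: "x \<in> K \<Longrightarrow> y \<in> K \<Longrightarrow> x - y \<in> K"
  using K by (auto simp: add_subgroup_def)

lemma add_subgroup_minus: "x \<in> K \<Longrightarrow> - x \<in> K"
  using add_subgroup_diff[of 0 x] add_subgroup_zero by simp

lemma add_subgroup_add: "x \<in> K \<Longrightarrow> y \<in> K \<Longrightarrow> x + y \<in> K"
  using add_subgroup_diff[of x "- y"] add_subgroup_minus by simp

lemma add_subgroup_sum: "(\<And>i. i \<in> I \<Longrightarrow> f i \<in> K) \<Longrightarrow> sum f I \<in> K"
  by (induction I rule: infinite_finite_induct) (auto simp: add_subgroup_zero add_subgroup_add)

lemma add_subgroup_nmult: "x \<in> K \<Longrightarrow> n \<cdot> x \<in> K"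
  by (induction n) (auto simp: add_subgroup_zero add_subgroup_add)

lemma add_subgroup_nmult_vimage: "add_subgroup {z. n \<cdot> z \<in> K}"
  unfolding add_subgroup_def by (auto simp: nmult_diff add_subgroup_zero add_subgroup_diff)

lemma add_subgroup_cong: "x - y \<in> K \<Longrightarrow> x \<in> K \<longleftrightarrow> y \<in> K"
  using add_subgroup_add[of "x - y" y] add_subgroup_diff[of x "x - y"] by auto

end

text \<open>B. H. Neumann's covering argument: a coset of \<open>H i\<close> that is missed by the \<open>H i\<close>-part of a
  finite cover is covered by cosets of the other subgroups, hence so is the whole group.\<close>

lemma neumann_cosets:
  fixes H :: "'i \<Rightarrow> 'a::ab_group_add set"
  assumes "finite I" "\<And>i. i \<in> I \<Longrightarrow> add_subgroup (H i)" "\<And>i. i \<in> I \<Longrightarrow> infinite_index (H i)"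
    and "finite F"
  shows "\<exists>z. \<forall>i\<in>I. \<forall>f\<in>F. z - f \<notin> H i"
  using assms
proof (induction I arbitrary: F rule: finite_induct)
  case (insert i I)
  have sub: "add_subgroup (H i)" and idx: "infinite_index (H i)" using insert.prems by auto
  obtain u where u: "\<forall>f\<in>F. u - f \<notin> H i"
    using idx insert.prems(3) unfolding infinite_index_def by blast
  \<comment> \<open>The additional points make \<open>z\<close> still avoid the cosets of the other
    subgroups after it is moved to \<open>z - f + u\<close>.\<close>
  define F' where "F' = F \<union> (\<lambda>(f,f'). f - u + f') ` (F \<times> F)"
  have "finite F'" unfolding F'_def using insert.prems(3) by auto
  then obtain z where z: "\<forall>i\<in>I. \<forall>f\<in>F'. z - f \<notin> H i"
    using insert.IH insert.prems by (metis insert_iff)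
  show ?case
  proof (cases "\<exists>f\<in>F. z - f \<in> H i")
    case False
    then show ?thesis using z by (intro exI[of _ z]) (auto simp: F'_def)
  next
    case True
    then obtain f where f: "f \<in> F" "z - f \<in> H i" by blast
    \<comment> \<open>The moved point is congruent to \<open>u\<close> modulo \<open>H i\<close>,
      and \<open>u\<close> misses the cosets of \<open>H i\<close>.\<close>
    have "z - f + u - f' \<notin> H j" if "j \<in> insert i I" "f' \<in> F" for j f'
    proof (cases "j = i")
      case True
      have "(z - f + u - f') - (u - f') \<in> H i" using f by simp
      then show ?thesis using u that True add_subgroup_cong[OF sub] by blast
    next
      case False
      have "f - u + f' \<in> F'" using f that unfolding F'_def by force
      moreover have "z - (f - u + f') = z - f + u - f'" by (simp add: algebra_simps)
      ultimately show ?thesis using z that False by (metis insertE)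
    qed
    then show ?thesis by blast
  qed
qed simp

text \<open>The subgroup generated by a countably infinite set, realised as finite sums of its
  elements and their negatives.\<close>

lemma exists_countable_infinite_subgroup:
  assumes "infinite (UNIV :: 'a::ab_group_add set)"
  shows "\<exists>C :: 'a set. countable C \<and> infinite C \<and> add_subgroup C"
proof -
  obtain S :: "'a set" where S: "countable S" "infinite S"
    using infinite_countable_subset'[OF assms] by blast
  define C where "C = sum_list ` lists (S \<union> uminus ` S)"
  have "countable C" unfolding C_def using S by auto
  moreover have "S \<subseteq> C"
  proof
    fix s assume "s \<in> S"
    then show "s \<in> C" unfolding C_def by (intro image_eqI[of _ _ "[s]"]) auto
  qed
  then have "infinite C" using S finite_subset by blast
  moreover have "add_subgroup C"
    unfolding add_subgroup_def
  proof (intro conjI ballI)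
    show "0 \<in> C" unfolding C_def by (intro image_eqI[of _ _ "[]"]) auto
    have neg: "sum_list (map uminus xs) = - sum_list xs" for xs :: "'a list"
      by (induction xs) auto
    fix x y assume "x \<in> C" "y \<in> C"
    then obtain xs ys where "xs \<in> lists (S \<union> uminus ` S)" "ys \<in> lists (S \<union> uminus ` S)"
      "x = sum_list xs" "y = sum_list ys" unfolding C_def by blast
    moreover have "map uminus ys \<in> lists (S \<union> uminus ` S)"
      using \<open>ys \<in> _\<close> by (induction ys) auto
    ultimately show "x - y \<in> C" unfolding C_def
      by (intro image_eqI[of _ _ "xs @ map uminus ys"]) (simp_all add: neg)
  qed
  ultimately show ?thesis by blast
qed

text \<open>For each \<open>c\<close> the solutions are absent or form a translate of the
  \<open>n\<close>-torsion modulo \<open>K\<close>, so these are countably many countable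
  fibres.\<close>

lemma countable_mod_nmult_vimage:
  assumes K: "add_subgroup K" and T: "countable_mod K {z. n \<cdot> z \<in> K}" and C: "countable C"
  shows "countable_mod K {z. \<exists>c\<in>C. n \<cdot> z - c \<in> K}"
proof -
  obtain R where R: "countable R" "\<And>s. n \<cdot> s \<in> K \<Longrightarrow> \<exists>r\<in>R. s - r \<in> K"
    using T unfolding countable_mod_def by auto
  define w where "w c = (SOME z. n \<cdot> z - c \<in> K)" for c
  have w: "n \<cdot> w c - c \<in> K" if "n \<cdot> z - c \<in> K" for c z
    unfolding w_def by (rule someI[of "\<lambda>z. n \<cdot> z - c \<in> K", OF that])
  have "\<exists>r\<in>(\<lambda>(c,r). w c + r) ` (C \<times> R). z - r \<in> K" if z: "c \<in> C" "n \<cdot> z - c \<in> K" for z c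
  proof -
    have "(n \<cdot> z - c) - (n \<cdot> w c - c) \<in> K"
      using z w add_subgroup_diff[OF K] by blast
    then have "n \<cdot> (z - w c) \<in> K" by (simp add: nmult_diff)
    then obtain r where r: "r \<in> R" "z - w c - r \<in> K" using R by blast
    show ?thesis
      by (rule bexI[of _ "w c + r"]) (use r z in \<open>auto simp: algebra_simps\<close>)
  qed
  then show ?thesis unfolding countable_mod_def
    using R(1) C by (intro exI[of _ "(\<lambda>(c,r). w c + r) ` (C \<times> R)"]) auto
qed

text \<open>A subgroup maximal subject to meeting a countably infinite subgroup \<open>C\<close> trivially makes
  the quotient an essential extension of \<open>C\<close>, hence countable.\<close>

lemma exists_countable_infinite_quotient:
  assumes "infinite (UNIV :: 'a::ab_group_add set)"
  shows "\<exists>K :: 'a set. add_subgroup K \<and> infinite_index K \<and> countable_mod K UNIV"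
proof -
  obtain C :: "'a set" where C: "countable C" "infinite C" "add_subgroup C"
    using exists_countable_infinite_subgroup[OF assms] by blast
  define \<K> where "\<K> = {K. add_subgroup K \<and> K \<inter> C = {0}}"
  have "\<exists>K\<in>\<K>. \<forall>X\<in>\<K>. K \<subseteq> X \<longrightarrow> X = K"
  proof (rule subset_Zorn_nonempty)
    have "{0} \<in> \<K>" using C by (auto simp: \<K>_def add_subgroup_def)
    then show "\<K> \<noteq> {}" by blast
    fix Ch assume Ch: "Ch \<noteq> {}" "subset.chain \<K> Ch"
    then have sub: "Ch \<subseteq> \<K>" by (auto simp: subset.chain_def)
    have "add_subgroup (\<Union>Ch)"
      unfolding add_subgroup_def
    proof (intro conjI ballI)
      show "0 \<in> \<Union>Ch" using Ch sub by (auto simp: \<K>_def add_subgroup_def)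
      fix x y assume "x \<in> \<Union>Ch" "y \<in> \<Union>Ch"
      then obtain X Y where XY: "X \<in> Ch" "x \<in> X" "Y \<in> Ch" "y \<in> Y" by blast
      then have "X \<subseteq> Y \<or> Y \<subseteq> X" using Ch(2) unfolding subset.chain_def by blast
      then obtain X where "X \<in> Ch" "x \<in> X" "y \<in> X" using XY by blast
      then show "x - y \<in> \<Union>Ch" using sub by (auto simp: \<K>_def add_subgroup_def)
    qed
    moreover have "\<Union>Ch \<inter> C = {0}" using Ch(1) sub by (auto simp: \<K>_def)
    ultimately show "\<Union>Ch \<in> \<K>" by (simp add: \<K>_def)
  qed
  then obtain K where "K \<in> \<K>" "\<forall>X\<in>\<K>. K \<subseteq> X \<longrightarrow> X = K" by blast
  then have K: "add_subgroup K" "K \<inter> C = {0}"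
    and max: "\<And>X. add_subgroup X \<Longrightarrow> X \<inter> C = {0} \<Longrightarrow> K \<subseteq> X \<Longrightarrow> X = K"
    by (simp_all add: \<K>_def)
  note Kadd = add_subgroup_add[OF K(1)] and Kdiff = add_subgroup_diff[OF K(1)]
    and Kminus = add_subgroup_minus[OF K(1)] and Kcong = add_subgroup_cong[OF K(1)]
  \<comment> \<open>By maximality, adjoining \<open>g\<close> to \<open>K\<close> must produce a
    nonzero element of \<open>C\<close>.\<close>
  have essential: "\<exists>j\<ge>1. \<exists>c\<in>C. c \<noteq> 0 \<and> j \<cdot> g - c \<in> K" if g: "g \<notin> K" for g
  proof -
    \<comment> \<open>The subgroup generated by \<open>K\<close> and \<open>g\<close>; the pair
      \<open>m\<close>, \<open>n\<close> encodes an integer coefficient.\<close>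
    define X where "X = {x. \<exists>m n. x + m \<cdot> g - n \<cdot> g \<in> K}"
    have XI: "x \<in> X" if "x + m \<cdot> g - n \<cdot> g \<in> K" for x m n using that unfolding X_def by blast
    have "K \<subseteq> X" using XI[of _ 0 0] by auto
    moreover have "g \<in> X" using XI[of g 0 1] add_subgroup_zero[OF K(1)] by simp
    moreover have "add_subgroup X"
      unfolding add_subgroup_def
    proof (intro conjI ballI)
      show "0 \<in> X" using XI[of 0 0 0] add_subgroup_zero[OF K(1)] by simp
      fix x y assume "x \<in> X" "y \<in> X"
      then obtain m n m' n' where "x + m \<cdot> g - n \<cdot> g \<in> K" "y + m' \<cdot> g - n' \<cdot> g \<in> K"
        unfolding X_def by blast
      from Kdiff[OF this] show "x - y \<in> X"
        by (intro XI[of _ "m + n'" "n + m'"]) (simp add: nmult_add_left algebra_simps)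
    qed
    ultimately have "X \<inter> C \<noteq> {0}" using max[of X] g by metis
    moreover have "0 \<in> X \<inter> C"
      using \<open>add_subgroup X\<close> C(3) by (auto simp: add_subgroup_def)
    ultimately obtain c where c: "c \<in> X" "c \<in> C" "c \<noteq> 0" by blast
    then obtain m n where mn: "c + m \<cdot> g - n \<cdot> g \<in> K" unfolding X_def by blast
    have "m \<noteq> n"
    proof
      assume "m = n"
      then have "c \<in> K" using mn by simp
      then show False using c K(2) by blast
    qed
    then consider "m < n" | "n < m" by linarith
    then show ?thesis
    proof cases
      case 1
      have "(n - m) \<cdot> g - c = - (c + m \<cdot> g - n \<cdot> g)"
        using 1 by (simp add: nmult_diff_left algebra_simps)
      then have "(n - m) \<cdot> g - c \<in> K" using Kminus[OF mn] by (simp only:)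
      moreover have "n - m \<ge> 1" using 1 by simp
      ultimately show ?thesis using c by blast
    next
      case 2
      have "(m - n) \<cdot> g - (- c) = c + m \<cdot> g - n \<cdot> g"
        using 2 by (simp add: nmult_diff_left algebra_simps)
      then have "(m - n) \<cdot> g - (- c) \<in> K" using mn by (simp only:)
      moreover have "m - n \<ge> 1" "- c \<in> C" "- c \<noteq> 0"
        using 2 c add_subgroup_minus[OF C(3)] by auto
      ultimately show ?thesis by blast
    qed
  qed
  have Kun: "countable_mod K (\<Union>i::nat. S i)" if "\<And>i. countable_mod K (S i)" for S
  proof -
    have "\<exists>R. \<forall>i. countable (R i) \<and> (\<forall>s\<in>S i. \<exists>r\<in>R i. s - r \<in> K)"
      by (rule choice) (use that in \<open>simp add: countable_mod_def\<close>)
    then obtain R where "\<forall>i. countable (R i) \<and> (\<forall>s\<in>S i. \<exists>r\<in>R i. s - r \<in> K)" ..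
    then have R: "\<And>i. countable (R i)" "\<And>i s. s \<in> S i \<Longrightarrow> \<exists>r\<in>R i. s - r \<in> K"
      by simp_all
    have "\<exists>r\<in>(\<Union>i. R i). s - r \<in> K" if "s \<in> (\<Union>i. S i)" for s
    proof -
      obtain i where "s \<in> S i" using \<open>s \<in> (\<Union>i. S i)\<close> by (rule UN_E)
      then obtain r where "r \<in> R i" "s - r \<in> K" using R(2) by meson
      then show ?thesis by (intro bexI[of _ r] UN_I[of i]) simp_all
    qed
    then show ?thesis unfolding countable_mod_def
      using R(1) by (intro exI[of _ "\<Union>i. R i"]) simp
  qed
  define D where "D j = {z. \<exists>c\<in>C. j \<cdot> z - c \<in> K}" for j
  have KD: "countable_mod K (D j)" if "countable_mod K {z. j \<cdot> z \<in> K}" for j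
    unfolding D_def by (rule countable_mod_nmult_vimage[OF K(1) that C(1)])
  have K0: "countable_mod K K" unfolding countable_mod_def by (intro exI[of _ "{0}"]) auto
  \<comment> \<open>Strong induction: if \<open>j \<cdot> z\<close> is congruent to a nonzero
    \<open>c\<close> in \<open>C\<close>, so is \<open>(j mod n) \<cdot> z\<close>, and a zero
    remainder would put \<open>c\<close> into \<open>K\<close>. Hence the torsion outside
    \<open>K\<close> lies in layers with smaller positive multipliers.\<close>
  have tors: "countable_mod K {z. n \<cdot> z \<in> K}" if "n \<ge> 1" for n
    using that
  proof (induction n rule: less_induct)
    case (less n)
    define S where "S j = (if 1 \<le> j \<and> j < n then D j else K)" for j
    have "countable_mod K (\<Union>j. S j)"
      by (rule Kun) (use less.IH KD K0 in \<open>auto simp: S_def\<close>)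
    moreover have "{z. n \<cdot> z \<in> K} \<subseteq> (\<Union>j. S j)"
    proof
      fix z assume z: "z \<in> {z. n \<cdot> z \<in> K}"
      show "z \<in> (\<Union>j. S j)"
      proof (cases "z \<in> K")
        case True
        then show ?thesis by (auto simp: S_def intro!: exI[of _ 0])
      next
        case False
        then obtain j c where j: "c \<in> C" "c \<noteq> 0" "j \<cdot> z - c \<in> K" using essential by blast
        have "(j div n * n + j mod n) \<cdot> z = (j div n) \<cdot> n \<cdot> z + (j mod n) \<cdot> z"
          by (simp only: nmult_add_left nmult_mult)
        then have "j \<cdot> z - c - ((j mod n) \<cdot> z - c) = (j div n) \<cdot> n \<cdot> z" by simp
        then have r: "(j mod n) \<cdot> z - c \<in> K"
          using j(3) z Kcong add_subgroup_nmult[OF K(1)] by (metis mem_Collect_eq)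
        have "j mod n \<noteq> 0"
        proof
          assume "j mod n = 0"
          then have "c \<in> K" using r Kminus[of "- c"] by simp
          then show False using j K(2) by blast
        qed
        then have "z \<in> S (j mod n)" using r j less.prems by (auto simp: S_def D_def)
        then show ?thesis by blast
      qed
    qed
    ultimately show ?case by (rule countable_mod_mono[OF _ order.refl])
  qed
  \<comment> \<open>The shift to \<open>Suc j\<close> leaves out multiplication by zero, whose
    torsion is the whole group.\<close>
  have "countable_mod K (\<Union>j. D (Suc j))" by (intro Kun KD tors) simp
  moreover have "(\<Union>j. D (Suc j)) = UNIV"
  proof -
    have "z \<in> (\<Union>j. D (Suc j))" for z
    proof (cases "z \<in> K")
      case False
      then obtain j c where "j \<ge> 1" "c \<in> C" "j \<cdot> z - c \<in> K" using essential by blast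
      then show ?thesis by (intro UN_I[of "j - 1"]) (auto simp: D_def)
    next
      case True
      then have "Suc 0 \<cdot> z - 0 \<in> K" by simp
      then have "z \<in> D (Suc 0)"
        unfolding D_def using add_subgroup_zero[OF C(3)] by blast
      then show ?thesis by blast
    qed
    then show ?thesis by blast
  qed
  ultimately have "countable_mod K UNIV" by simp
  moreover have "infinite_index K"
    unfolding infinite_index_def
  proof (intro allI impI, rule ccontr)
    fix F :: "'a set" assume F: "finite F" and "\<nexists>z. \<forall>f\<in>F. z - f \<notin> K"
    then obtain w where w: "\<And>z. w z \<in> F \<and> z - w z \<in> K" by metis
    \<comment> \<open>Distinct elements of \<open>C\<close> are incongruent modulo \<open>K\<close>,
      so finitely many cosets cannot contain \<open>C\<close>.\<close>
    have "inj_on w C"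
    proof (rule inj_onI)
      fix x y assume xy: "x \<in> C" "y \<in> C" "w x = w y"
      have "x - w x - (y - w y) \<in> K" using w Kdiff by blast
      then have "x - y \<in> K" using xy by simp
      moreover have "x - y \<in> C" using xy add_subgroup_diff[OF C(3)] by blast
      ultimately have "x - y \<in> {0}" using K(2) by blast
      then show "x = y" by simp
    qed
    then have "finite C" by (rule inj_on_finite[OF _ _ F]) (use w in auto)
    then show False using C by simp
  qed
  ultimately show ?thesis using K(1) by blast
qed

text \<open>Whenever \<open>m \<cdot> (G/K)\<close> is finite and nonzero, factor it out; this changes the quotient by a
  finite subgroup only, and terminates because the set of \<open>m \<le> h\<close> that kill the quotient grows.\<close>

lemma exists_good_quotient:
  assumes "infinite (UNIV :: 'a::ab_group_add set)"
  shows "\<exists>K :: 'a set. add_subgroup K \<and> infinite_index K \<and> countable_mod K UNIV \<and>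
    (\<forall>m\<le>h. (\<forall>z. m \<cdot> z \<in> K) \<or> infinite_index {z. m \<cdot> z \<in> K})"
proof -
  define P where "P K \<longleftrightarrow> add_subgroup K \<and> infinite_index K \<and> countable_mod K UNIV" for K :: "'a set"
  define kill where "kill K = {m. m \<le> h \<and> (\<forall>z. m \<cdot> z \<in> K)}" for K :: "'a set"
  have finkill: "finite (kill K)" for K unfolding kill_def by simp
  have "card (kill K) < h + 2" for K
  proof -
    have "card (kill K) \<le> card {..h}" by (rule card_mono) (auto simp: kill_def)
    then show ?thesis by simp
  qed
  moreover obtain K0 where "P K0"
    using exists_countable_infinite_quotient[OF assms] unfolding P_def by blast
  \<comment> \<open>An extremal choice in place of repeated factoring: no admissible
    \<open>K'\<close> kills more multipliers.\<close>
  ultimately obtain K where K: "P K" and max: "\<And>K'. P K' \<Longrightarrow> card (kill K') \<le> card (kill K)"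
    using ex_has_greatest_nat[of P K0 "\<lambda>K. card (kill K)" "h + 2"] by blast
  have Ksub: "add_subgroup K" and Kidx: "infinite_index K" and Kcm: "countable_mod K UNIV"
    using K by (auto simp: P_def)
  have "infinite_index {z. m \<cdot> z \<in> K}" if m: "m \<le> h" "\<not> (\<forall>z. m \<cdot> z \<in> K)" for m
  proof (rule ccontr)
    assume "\<not> ?thesis"
    then obtain F where F: "finite F" "\<And>z. \<exists>f\<in>F. m \<cdot> (z - f) \<in> K"
      unfolding infinite_index_def by auto
    \<comment> \<open>The sum of \<open>K\<close> and the image of multiplication by
      \<open>m\<close>, consisting of finitely many cosets of \<open>K\<close>.\<close>
    define K' where "K' = {x. \<exists>z. x - m \<cdot> z \<in> K}"
    have K'I: "x \<in> K'" if "x - m \<cdot> z \<in> K" for x z using that unfolding K'_def by blast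
    have KK': "K \<subseteq> K'" using K'I[of _ 0] by auto
    have "add_subgroup K'"
      unfolding add_subgroup_def
    proof (intro conjI ballI)
      show "0 \<in> K'" using KK' add_subgroup_zero[OF Ksub] by blast
      fix x y assume "x \<in> K'" "y \<in> K'"
      then obtain z w where "x - m \<cdot> z \<in> K" "y - m \<cdot> w \<in> K" unfolding K'_def by blast
      from add_subgroup_diff[OF Ksub this] show "x - y \<in> K'"
        by (intro K'I[of _ "z - w"]) (simp add: nmult_diff algebra_simps)
    qed
    moreover have "countable_mod K' UNIV" by (rule countable_mod_mono[OF Kcm KK']) simp
    moreover have "infinite_index K'"
      unfolding infinite_index_def
    proof (intro allI impI)
      fix F' :: "'a set" assume F': "finite F'"
      \<comment> \<open>A coset \<open>a + K'\<close> is the union of the cosets of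
        \<open>a + m \<cdot> b\<close> modulo \<open>K\<close> with \<open>b\<close> in
        \<open>F\<close>, so it suffices to avoid these.\<close>
      then have "finite ((\<lambda>(a,b). a + m \<cdot> b) ` (F' \<times> F))" using F by auto
      then obtain z where z: "\<forall>f\<in>(\<lambda>(a,b). a + m \<cdot> b) ` (F' \<times> F). z - f \<notin> K"
        using Kidx unfolding infinite_index_def by blast
      have "z - f' \<notin> K'" if f': "f' \<in> F'" for f'
      proof
        assume "z - f' \<in> K'"
        then obtain w where w: "z - f' - m \<cdot> w \<in> K" unfolding K'_def by blast
        obtain f where f: "f \<in> F" "m \<cdot> (w - f) \<in> K" using F by blast
        have "(z - f' - m \<cdot> w) + m \<cdot> (w - f) = z - (f' + m \<cdot> f)"
          by (simp add: nmult_diff algebra_simps)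
        then have "z - (f' + m \<cdot> f) \<in> K" using add_subgroup_add[OF Ksub w f(2)] by (simp only:)
        then show False using z f f' by force
      qed
      then show "\<exists>z. \<forall>f\<in>F'. z - f \<notin> K'" by blast
    qed
    ultimately have "P K'" by (simp add: P_def)
    have "m \<cdot> z \<in> K'" for z using K'I[of "m \<cdot> z" z] add_subgroup_zero[OF Ksub] by simp
    then have "kill K \<subset> kill K'" using KK' m unfolding kill_def by blast
    then have "card (kill K) < card (kill K')" by (rule psubset_card_mono[OF finkill])
    then show False using max[OF \<open>P K'\<close>] by simp
  qed
  then show ?thesis using Ksub Kidx Kcm by blast
qed

section \<open>The greedy construction\<close>

text \<open>Allowing fewer than \<open>h\<close> summands lets one commitment exclude all orders up
  to \<open>h\<close> at once.\<close>

definition msums :: "nat \<Rightarrow> 'a::ab_group_add set \<Rightarrow> 'a set" where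
  "msums h A = {sum_mset M | M. size M \<le> h \<and> set_mset M \<subseteq> A}"

lemma msums_mono: "A \<subseteq> B \<Longrightarrow> msums h A \<subseteq> msums h B"
  unfolding msums_def by blast

lemma subset_msums:
  assumes "h \<ge> 1"
  shows "A \<subseteq> msums h A"
proof
  fix a assume "a \<in> A"
  then show "a \<in> msums h A" unfolding msums_def
    using assms by (intro CollectI exI[of _ "{#a#}"]) auto
qed

lemma finite_msums: assumes "finite A" shows "finite (msums h A)"
proof -
  have "msums h A \<subseteq> sum_mset ` (\<Union>n\<le>h. multisets_of_size A n)"
    unfolding msums_def multisets_of_size_def by auto
  moreover have "finite (sum_mset ` (\<Union>n\<le>h. multisets_of_size A n))"
    using assms by auto
  ultimately show ?thesis by (rule finite_subset)
qed

text \<open>Sorts the summands into old ones, kept in \<open>M\<close>, and multiplicities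
  \<open>n\<close> of new ones, to which genericity applies. Elements of \<open>B\<close> count as
  old.\<close>

lemma msums_Un_imageE:
  fixes k :: nat
  assumes "s \<in> msums h (B \<union> b ` {..<k})"
  obtains M n where "set_mset M \<subseteq> B" "size M + (\<Sum>j<k. n j) \<le> h" "s = sum_mset M + (\<Sum>j<k. n j \<cdot> b j)"
proof -
  have split: "\<exists>M n. set_mset M \<subseteq> B \<and> size M + (\<Sum>j<k. n j) = size N \<and> sum_mset N = sum_mset M + (\<Sum>j<k. n j \<cdot> b j)"
    if "set_mset N \<subseteq> B \<union> b ` {..<k}" for N
    using that
  proof (induction N)
    case empty
    show ?case by (intro exI[of _ "{#}"] exI[of _ "\<lambda>_. 0"]) simp
  next
    case (add e N)
    then obtain M n where Mn: "set_mset M \<subseteq> B" "size M + (\<Sum>j<k. n j) = size N"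
      "sum_mset N = sum_mset M + (\<Sum>j<k. n j \<cdot> b j)" by auto
    show ?case
    proof (cases "e \<in> B")
      case True
      show ?thesis
        by (intro exI[of _ "add_mset e M"] exI[of _ n]) (use Mn True in \<open>simp add: algebra_simps\<close>)
    next
      case False
      then obtain i where i: "i < k" "e = b i" using add.prems by auto
      have "(\<Sum>j<k. (n(i := Suc (n i))) j) = (\<Sum>j<k. n j + (if j = i then 1 else 0))"
        by (intro sum.cong) auto
      then have "(\<Sum>j<k. (n(i := Suc (n i))) j) = Suc (\<Sum>j<k. n j)"
        using i by (simp only: sum.distrib) simp
      moreover have "(\<Sum>j<k. (n(i := Suc (n i))) j \<cdot> b j) = (\<Sum>j<k. (if j = i then e else 0) + n j \<cdot> b j)"
        using i by (intro sum.cong) auto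
      then have "(\<Sum>j<k. (n(i := Suc (n i))) j \<cdot> b j) = e + (\<Sum>j<k. n j \<cdot> b j)"
        using i by (simp only: sum.distrib) simp
      ultimately show ?thesis
        by (intro exI[of _ M] exI[of _ "n(i := Suc (n i))"]) (use Mn in \<open>simp add: algebra_simps\<close>)
    qed
  qed
  obtain N where N: "s = sum_mset N" "size N \<le> h" "set_mset N \<subseteq> B \<union> b ` {..<k}"
    using assms unfolding msums_def by blast
  obtain M n where "set_mset M \<subseteq> B" "size M + (\<Sum>j<k. n j) = size N"
    "sum_mset N = sum_mset M + (\<Sum>j<k. n j \<cdot> b j)" using split[OF N(3)] by blast
  then show ?thesis using N by (intro that[of M n]) simp_all
qed

lemma msums_insertE:
  assumes "s \<in> msums h (insert y B)"
  obtains n t where "n \<le> h" "t \<in> msums h B" "s = t + n \<cdot> y"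
proof -
  have "s \<in> msums h (B \<union> (\<lambda>_. y) ` {..<1::nat})" using assms by (simp add: lessThan_Suc)
  then obtain M n where Mn: "set_mset M \<subseteq> B" "size M + (\<Sum>j<1. n j) \<le> h"
    "s = sum_mset M + (\<Sum>j<1::nat. n j \<cdot> y)" by (rule msums_Un_imageE)
  have "sum_mset M \<in> msums h B" unfolding msums_def
    using Mn(1,2) by (intro CollectI exI[of _ M]) simp
  moreover have "n 0 \<le> h" "s = sum_mset M + n 0 \<cdot> y" using Mn(2,3) by simp_all
  ultimately show ?thesis using that by blast
qed

text \<open>The first components of \<open>P\<close> are the special elements. The last clause keeps
  old non-special elements non-special, so that the witnesses for covering survive to the
  limit.\<close>

definition extends :: "'a set \<Rightarrow> ('a \<times> 'a) set \<Rightarrow> 'a set \<Rightarrow> ('a \<times> 'a) set \<Rightarrow> bool" where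
  "extends A P A' P' \<longleftrightarrow> A \<subseteq> A' \<and> P \<subseteq> P' \<and> fst ` P' \<inter> A \<subseteq> fst ` P"

lemma extends_refl: "extends A P A P"
  unfolding extends_def by blast

lemma extends_trans: "extends A P A' P' \<Longrightarrow> extends A' P' A'' P'' \<Longrightarrow> extends A P A'' P''"
  unfolding extends_def by blast

lemma infinite_UN_increasing:
  fixes Q :: "nat \<Rightarrow> 'a set"
  assumes sub: "\<And>n. Q n \<subseteq> Q (Suc n)" and new: "\<And>n. N \<le> n \<Longrightarrow> \<not> Q (Suc n) \<subseteq> Q n"
  shows "infinite (\<Union>n. Q n)"
proof
  assume fin: "finite (\<Union>n. Q n)"
  have finQ: "finite (Q n)" for n using fin by (rule finite_subset[rotated]) blast
  have "i \<le> card (Q (N + i))" for i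
  proof (induction i)
    case (Suc i)
    have "Q (N + i) \<subset> Q (Suc (N + i))" using sub[of "N + i"] new[of "N + i"] by auto
    then have "card (Q (N + i)) < card (Q (Suc (N + i)))" by (rule psubset_card_mono[OF finQ])
    then show ?case using Suc by simp
  qed simp
  moreover have "card (Q n) \<le> card (\<Union>n. Q n)" for n by (rule card_mono[OF fin]) blast
  ultimately show False by (meson not_less_eq_eq order.trans)
qed

section \<open>Generic elements modulo a good subgroup\<close>

locale good_quotient =
  fixes K :: "'a::ab_group_add set" and h :: nat
  assumes subgroup: "add_subgroup K" and index: "infinite_index K"
    and good: "m \<le> h \<Longrightarrow> (\<forall>z. m \<cdot> z \<in> K) \<or> infinite_index {z. m \<cdot> z \<in> K}"
    and h2: "h \<ge> 2"
begin

lemmas K_zero = add_subgroup_zero[OF subgroup] and K_add = add_subgroup_add[OF subgroup]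
  and K_diff = add_subgroup_diff[OF subgroup] and K_minus = add_subgroup_minus[OF subgroup]
  and K_cong = add_subgroup_cong[OF subgroup] and K_sum = add_subgroup_sum[OF subgroup]

lemma exists_notin_K: "\<exists>z. z \<notin> K"
  using index[unfolded infinite_index_def, rule_format, of "{0}"] by auto

text \<open>The \<open>y\<close> with \<open>m \<cdot> y\<close> congruent to a given
  \<open>c\<close> lie in one coset of the \<open>m\<close>-torsion modulo \<open>K\<close>. Unless
  \<open>m\<close> annihilates the quotient, this torsion has infinite index, so Neumann's argument
  avoids the finitely many cosets.\<close>

lemma exists_fresh:
  assumes F: "finite F"
  shows "\<exists>y. \<forall>n\<le>h. \<forall>m\<le>h. \<forall>c\<in>F. n \<cdot> y - m \<cdot> y - c \<in> K \<longrightarrow> (\<forall>z. n \<cdot> z - m \<cdot> z \<in> K)"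
proof -
  define I where "I = {m. m \<le> h \<and> \<not> (\<forall>z. m \<cdot> z \<in> K)}"
  \<comment> \<open>Negatives serve the case \<open>n < m\<close>, where \<open>m - n\<close> is the
    natural multiplier.\<close>
  define G where "G = F \<union> uminus ` F"
  define w where "w m c = (SOME z. m \<cdot> z - c \<in> K)" for m c
  have w: "m \<cdot> w m c - c \<in> K" if "m \<cdot> z - c \<in> K" for m c z
    unfolding w_def by (rule someI[of "\<lambda>z. m \<cdot> z - c \<in> K", OF that])
  define F' where "F' = case_prod w ` (I \<times> G)"
  have finI: "finite I" unfolding I_def by simp
  then have finF': "finite F'" unfolding F'_def G_def using F by auto
  have "\<exists>y. \<forall>m\<in>I. \<forall>f\<in>F'. y - f \<notin> {z. m \<cdot> z \<in> K}"
  proof (rule neumann_cosets[OF finI _ _ finF'])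
    fix m assume "m \<in> I"
    then show "infinite_index {z. m \<cdot> z \<in> K}" using good[of m] unfolding I_def by blast
  qed (rule add_subgroup_nmult_vimage[OF subgroup])
  then obtain y where y: "\<And>m f. m \<in> I \<Longrightarrow> f \<in> F' \<Longrightarrow> m \<cdot> (y - f) \<notin> K" by auto
  have key: "\<forall>z. m \<cdot> z \<in> K" if m: "m \<le> h" and c: "c \<in> G" and in_K: "m \<cdot> y - c \<in> K" for m c
  proof (rule ccontr)
    assume "\<not> (\<forall>z. m \<cdot> z \<in> K)"
    then have mI: "m \<in> I" using m by (simp add: I_def)
    have "(m \<cdot> y - c) - (m \<cdot> w m c - c) \<in> K" by (rule K_diff[OF in_K w[OF in_K]])
    then have "m \<cdot> (y - w m c) \<in> K" by (simp add: nmult_diff)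
    moreover have "w m c \<in> F'" unfolding F'_def using mI c by (intro image_eqI[of _ _ "(m, c)"]) auto
    ultimately show False using y mI by blast
  qed
  have "n \<cdot> z - m \<cdot> z \<in> K" if nm: "n \<le> h" "m \<le> h" and c: "c \<in> F" and in_K: "n \<cdot> y - m \<cdot> y - c \<in> K"
    for n m c z
  proof (cases "m \<le> n")
    case True
    have "(n - m) \<cdot> y - c \<in> K" using in_K True by (simp add: nmult_diff_left)
    then have "(n - m) \<cdot> z \<in> K" using key[of "n - m" c] nm c by (simp add: G_def)
    then show ?thesis using True by (simp add: nmult_diff_left)
  next
    case False
    have "(m - n) \<cdot> y - (- c) = - (n \<cdot> y - m \<cdot> y - c)"
      using False by (simp add: nmult_diff_left algebra_simps)
    then have "(m - n) \<cdot> y - (- c) \<in> K" using K_minus[OF in_K] by (simp only:)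
    then have "(m - n) \<cdot> z \<in> K" using key[of "m - n" "- c"] nm c by (simp add: G_def)
    then have "- (m \<cdot> z - n \<cdot> z) \<in> K" using False by (intro K_minus) (simp add: nmult_diff_left)
    then show ?thesis by simp
  qed
  then show ?thesis by blast
qed

text \<open>Each new \<open>b k\<close> is chosen generic over the finitely many values of the
  earlier combinations. The coefficient \<open>m\<close> anticipates the multiplicity of a further
  summand, the target minus the sum of all \<open>b j\<close>.\<close>

lemma exists_fresh_family:
  assumes F: "finite F"
  shows "\<exists>b. \<forall>(n :: nat \<Rightarrow> nat) m. \<forall>c\<in>F. (\<forall>j<k. n j \<le> h) \<longrightarrow> m \<le> h \<longrightarrow>
    (\<Sum>j<k. n j \<cdot> b j) - m \<cdot> (\<Sum>j<k. b j) - c \<in> K \<longrightarrow> (\<forall>j<k. \<forall>z. n j \<cdot> z - m \<cdot> z \<in> K)"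
proof (induction k)
  case 0
  show ?case by simp
next
  case (Suc k)
  then obtain b where b: "\<And>n m c j z. c \<in> F \<Longrightarrow> (\<And>j. j < k \<Longrightarrow> n j \<le> h) \<Longrightarrow> m \<le> h \<Longrightarrow>
    (\<Sum>j<k. n j \<cdot> b j) - m \<cdot> (\<Sum>j<k. b j) - c \<in> K \<Longrightarrow> j < k \<Longrightarrow> n j \<cdot> z - m \<cdot> z \<in> K"
    by blast
  define L where "L n m = (\<Sum>j<k. n j \<cdot> b j) - m \<cdot> (\<Sum>j<k. b j)" for n :: "nat \<Rightarrow> nat" and m
  define F' where "F' = (\<lambda>(n,m,c). c - L n m) ` ((\<Pi>\<^sub>E j\<in>{..<k}. {..h}) \<times> {..h} \<times> F)"
  have "finite F'" unfolding F'_def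
    by (intro finite_imageI finite_cartesian_product finite_PiE) (auto simp: F)
  then obtain y where y: "\<And>n m c z. n \<le> h \<Longrightarrow> m \<le> h \<Longrightarrow> c \<in> F' \<Longrightarrow>
      n \<cdot> y - m \<cdot> y - c \<in> K \<Longrightarrow> n \<cdot> z - m \<cdot> z \<in> K"
    using exists_fresh by meson
  define b' where "b' = b(k := y)"
  have "n j \<cdot> z - m \<cdot> z \<in> K"
    if c: "c \<in> F" and n: "\<forall>j<Suc k. n j \<le> h" and m: "m \<le> h" and j: "j < Suc k"
      and in_K: "(\<Sum>j<Suc k. n j \<cdot> b' j) - m \<cdot> (\<Sum>j<Suc k. b' j) - c \<in> K" for n m c j z
  proof -
    have "(\<Sum>j<Suc k. n j \<cdot> b' j) - m \<cdot> (\<Sum>j<Suc k. b' j) - c = n k \<cdot> y - m \<cdot> y - (c - L n m)"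
      by (simp add: b'_def L_def nmult_add algebra_simps)
    then have 1: "n k \<cdot> y - m \<cdot> y - (c - L n m) \<in> K" using in_K by (simp only:)
    have "L (restrict n {..<k}) m = L n m" unfolding L_def by simp
    moreover have "restrict n {..<k} \<in> (\<Pi>\<^sub>E j\<in>{..<k}. {..h})" using n by auto
    ultimately have "c - L n m \<in> F'" unfolding F'_def using c m
      by (intro image_eqI[of _ _ "(restrict n {..<k}, m, c)"]) auto
    then have last: "n k \<cdot> z - m \<cdot> z \<in> K" for z using y[OF _ m _ 1] n by simp
    show ?thesis
    proof (cases "j = k")
      case False
      \<comment> \<open>The part in \<open>y\<close> vanishes modulo \<open>K\<close> and can be
        removed, leaving the relation for the first \<open>k\<close> elements.\<close>
      have "(n k \<cdot> y - m \<cdot> y) - (n k \<cdot> y - m \<cdot> y - (c - L n m)) \<in> K" by (rule K_diff[OF last 1])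
      then have "- (c - L n m) \<in> K" by (intro K_minus) simp
      then have "(\<Sum>j<k. n j \<cdot> b j) - m \<cdot> (\<Sum>j<k. b j) - c \<in> K" by (simp add: L_def)
      then show ?thesis using b[OF c _ m] n j False by simp
    qed (simp add: last)
  qed
  then show ?case by (intro exI[of _ b']) blast
qed

section \<open>Finite stages with commitments\<close>

text \<open>A pair \<open>(a, x) \<in> P\<close> records the commitment that \<open>x\<close>, modulo \<open>K\<close>, will never be a sum of at most
  \<open>h\<close> elements of the set under construction other than \<open>a\<close>.  The pairs \<open>(a, a)\<close> are what allows new
  commitments \<open>(a, a + y)\<close> to be made.\<close>

definition state :: "'a set \<Rightarrow> ('a \<times> 'a) set \<Rightarrow> bool" where
  "state A P \<longleftrightarrow> finite A \<and> finite P \<and> 0 \<in> A \<and> 0 \<notin> fst ` P \<and>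
    (\<forall>a x. (a, x) \<in> P \<longrightarrow> a \<in> A \<and> (a, a) \<in> P \<and> (\<exists>y\<in>A - fst ` P. x = a + y) \<and>
      (\<forall>s\<in>msums h (A - {a}). s - x \<notin> K))"

lemma stateD:
  assumes "state A P" "(a, x) \<in> P"
  shows "a \<in> A" "(a, a) \<in> P" "\<exists>y\<in>A - fst ` P. x = a + y" "\<And>s. s \<in> msums h (A - {a}) \<Longrightarrow> s - x \<notin> K"
  using assms unfolding state_def by blast+

text \<open>Genericity at \<open>m = 0\<close> makes \<open>y\<close> new modulo \<open>K\<close>
  and irrelevant to old commitments; at \<open>m = 1\<close> it reduces a representation of
  \<open>a + y\<close> to one of \<open>a\<close>.\<close>

lemma exists_fresh_element:
  assumes st: "state A P"
  obtains y where "y \<notin> A" "\<And>s. s \<in> msums h A \<Longrightarrow> y - s \<notin> K"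
    "\<And>n s x. n \<le> h \<Longrightarrow> s \<in> msums h A \<Longrightarrow> x \<in> snd ` P \<Longrightarrow> s + n \<cdot> y - x \<in> K \<Longrightarrow> s - x \<in> K"
    "\<And>n s a. n \<le> h \<Longrightarrow> s \<in> msums h A \<Longrightarrow> a \<in> A \<Longrightarrow> s + n \<cdot> y - (a + y) \<in> K \<Longrightarrow> s - a \<in> K"
proof -
  define F where "F = msums h A \<union> (\<lambda>(x,s). x - s) ` ((snd ` P \<union> A) \<times> msums h A)"
  have fin: "finite A" "finite P" using st by (simp_all add: state_def)
  then have "finite F" unfolding F_def
    by (intro finite_UnI finite_imageI finite_cartesian_product finite_msums) simp_all
  then obtain y where y: "\<And>n m c z. n \<le> h \<Longrightarrow> m \<le> h \<Longrightarrow> c \<in> F \<Longrightarrow>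
      n \<cdot> y - m \<cdot> y - c \<in> K \<Longrightarrow> n \<cdot> z - m \<cdot> z \<in> K"
    using exists_fresh by meson
  have FI: "x - s \<in> F" if "x \<in> snd ` P \<union> A" "s \<in> msums h A" for x s
    unfolding F_def using that by (intro UnI2 image_eqI[of _ _ "(x, s)"]) auto
  have 1: "y - s \<notin> K" if s: "s \<in> msums h A" for s
  proof
    assume "y - s \<in> K"
    then have "1 \<cdot> y - 0 \<cdot> y - s \<in> K" by simp
    then have "1 \<cdot> z - 0 \<cdot> z \<in> K" for z using y[of 1 0 s] s h2 by (simp add: F_def)
    then show False using exists_notin_K by simp
  qed
  have 2: "s - x \<in> K" if n: "n \<le> h" and s: "s \<in> msums h A" and x: "x \<in> snd ` P"
    and in_K: "s + n \<cdot> y - x \<in> K" for n s x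
  proof -
    have "n \<cdot> y - 0 \<cdot> y - (x - s) \<in> K" using in_K by (simp add: algebra_simps)
    then have "n \<cdot> y - 0 \<cdot> y \<in> K" by (intro y[OF n _ FI, of 0 x s]) (use x s in simp_all)
    then have "(s + n \<cdot> y - x) - (s - x) \<in> K" by simp
    then show ?thesis using in_K K_cong by blast
  qed
  have 3: "s - a \<in> K" if n: "n \<le> h" and s: "s \<in> msums h A" and a: "a \<in> A"
    and in_K: "s + n \<cdot> y - (a + y) \<in> K" for n s a
  proof -
    have "n \<cdot> y - 1 \<cdot> y - (a - s) \<in> K" using in_K by (simp add: algebra_simps)
    then have "n \<cdot> y - 1 \<cdot> y \<in> K" by (intro y[OF n _ FI, of 1 a s]) (use a s h2 in simp_all)
    then have "(s + n \<cdot> y - (a + y)) - (s - a) \<in> K" by simp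
    then show ?thesis using in_K K_cong by blast
  qed
  have "y \<notin> A" using 1 subset_msums[of h A] h2 K_zero by force
  then show ?thesis using that 1 2 3 by blast
qed

text \<open>Removing the copies of \<open>y\<close> from a violating sum would leave a violation in
  the old state.\<close>

lemma msums_insert_avoids:
  assumes "state A P" "(a, x) \<in> P"
    and y: "\<And>n s x. n \<le> h \<Longrightarrow> s \<in> msums h A \<Longrightarrow> x \<in> snd ` P \<Longrightarrow> s + n \<cdot> y - x \<in> K \<Longrightarrow> s - x \<in> K"
    and s: "s \<in> msums h (insert y A - {a})"
  shows "s - x \<notin> K"
proof
  assume in_K: "s - x \<in> K"
  have "s \<in> msums h (insert y (A - {a}))" using s msums_mono[of "insert y A - {a}" "insert y (A - {a})"] by blast
  then obtain n t where nt: "n \<le> h" "t \<in> msums h (A - {a})" "s = t + n \<cdot> y" by (rule msums_insertE)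
  have "t \<in> msums h A" using nt msums_mono[of "A - {a}" A] by blast
  then have "t - x \<in> K" using y[of n t x] nt in_K assms(2) by (metis image_eqI snd_conv)
  then show False using nt assms(1,2) unfolding state_def by blast
qed

text \<open>A fresh \<open>y\<close> is not congruent to any sum of old elements, so the commitment
  \<open>(y, y)\<close> holds at once.\<close>

lemma state_add_special:
  assumes st: "state A P"
  shows "\<exists>A' P'. state A' P' \<and> extends A P A' P' \<and> \<not> fst ` P' \<subseteq> fst ` P"
proof -
  obtain y where y: "y \<notin> A" "\<And>s. s \<in> msums h A \<Longrightarrow> y - s \<notin> K"
    "\<And>n s x. n \<le> h \<Longrightarrow> s \<in> msums h A \<Longrightarrow> x \<in> snd ` P \<Longrightarrow> s + n \<cdot> y - x \<in> K \<Longrightarrow> s - x \<in> K"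
    using exists_fresh_element[OF st] by metis
  have sub: "fst ` P \<subseteq> A" using st by (auto simp: state_def)
  have "state (insert y A) (insert (y, y) P)"
    unfolding state_def
  proof (intro conjI allI impI)
    show "0 \<notin> fst ` insert (y, y) P" using st y(1) by (auto simp: state_def)
    fix a x assume ax: "(a, x) \<in> insert (y, y) P"
    show "a \<in> insert y A" "(a, a) \<in> insert (y, y) P" using ax st by (auto simp: state_def)
    show "\<exists>z\<in>insert y A - fst ` insert (y, y) P. x = a + z"
    proof (cases "(a, x) \<in> P")
      case True
      then obtain z where "z \<in> A - fst ` P" "x = a + z" using stateD(3)[OF st] by blast
      then show ?thesis using y(1) by (intro bexI[of _ z]) auto
    next
      case False
      \<comment> \<open>The new pair is justified by \<open>y = y + 0\<close>, with \<open>0\<close>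
        as the non-special element.\<close>
      then show ?thesis using ax st y(1) by (intro bexI[of _ 0]) (auto simp: state_def)
    qed
    show "\<forall>s\<in>msums h (insert y A - {a}). s - x \<notin> K"
    proof (cases "(a, x) \<in> P")
      case True
      show ?thesis by (intro ballI msums_insert_avoids[OF st True]) (rule y(3))
    next
      case False
      then have ay: "a = y" "x = y" using ax by auto
      show ?thesis
      proof
        fix s assume "s \<in> msums h (insert y A - {a})"
        then have "s \<in> msums h A" using ay y(1) by simp
        then show "s - x \<notin> K" using y(2)[of s] K_minus[of "s - x"] ay by auto
      qed
    qed
  qed (use st in \<open>auto simp: state_def\<close>)
  moreover have "extends A P (insert y A) (insert (y, y) P)"
    using y(1) by (auto simp: extends_def)
  moreover have "\<not> fst ` insert (y, y) P \<subseteq> fst ` P" using y(1) sub by auto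
  ultimately show ?thesis by blast
qed

text \<open>A fresh \<open>y\<close> is added as a non-special element. A sum avoiding
  \<open>a\<close> and congruent to \<open>a + y\<close> would reduce to one congruent to
  \<open>a\<close>, against the commitment \<open>(a, a)\<close>.\<close>

lemma state_add_commitment:
  assumes st: "state A P" and a: "a \<in> fst ` P"
  shows "\<exists>A' P'. state A' P' \<and> extends A P A' P' \<and> (\<exists>x. (a, x) \<in> P' - P)"
proof -
  obtain y where y: "y \<notin> A"
    "\<And>n s x. n \<le> h \<Longrightarrow> s \<in> msums h A \<Longrightarrow> x \<in> snd ` P \<Longrightarrow> s + n \<cdot> y - x \<in> K \<Longrightarrow> s - x \<in> K"
    "\<And>n s a. n \<le> h \<Longrightarrow> s \<in> msums h A \<Longrightarrow> a \<in> A \<Longrightarrow> s + n \<cdot> y - (a + y) \<in> K \<Longrightarrow> s - a \<in> K"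
    using exists_fresh_element[OF st] by metis
  have sub: "fst ` P \<subseteq> A" using st by (auto simp: state_def)
  have aa: "(a, a) \<in> P" "a \<in> A" using a st by (auto simp: state_def)
  have fst: "fst ` insert (a, a + y) P = fst ` P" using a by auto
  have new: "(a, a + y) \<notin> P"
  proof
    assume "(a, a + y) \<in> P"
    then obtain z where "z \<in> A" "a + y = a + z" using stateD(3)[OF st] by blast
    then show False using y(1) by simp
  qed
  have "state (insert y A) (insert (a, a + y) P)"
    unfolding state_def fst
  proof (intro conjI allI impI)
    fix b x assume bx: "(b, x) \<in> insert (a, a + y) P"
    show "b \<in> insert y A" "(b, b) \<in> insert (a, a + y) P" using bx st aa by (auto simp: state_def)
    show "\<exists>z\<in>insert y A - fst ` P. x = b + z"
    proof (cases "(b, x) \<in> P")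
      case True
      then obtain z where "z \<in> A - fst ` P" "x = b + z" using stateD(3)[OF st] by blast
      then show ?thesis by (intro bexI[of _ z]) auto
    next
      case False
      then show ?thesis using bx y(1) sub by (intro bexI[of _ y]) auto
    qed
    show "\<forall>s\<in>msums h (insert y A - {b}). s - x \<notin> K"
    proof (cases "(b, x) \<in> P")
      case True
      show ?thesis by (intro ballI msums_insert_avoids[OF st True]) (rule y(2))
    next
      case False
      then have bx: "b = a" "x = a + y" using bx by auto
      show ?thesis
      proof (intro ballI notI)
        fix s assume s: "s \<in> msums h (insert y A - {b})" and in_K: "s - x \<in> K"
        have "s \<in> msums h (insert y (A - {a}))"
          using s bx msums_mono[of "insert y A - {a}" "insert y (A - {a})"] by blast
        then obtain n t where nt: "n \<le> h" "t \<in> msums h (A - {a})" "s = t + n \<cdot> y" by (rule msums_insertE)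
        have "t \<in> msums h A" using nt msums_mono[of "A - {a}" A] by blast
        then have "t - a \<in> K" using y(3)[of n t a] nt in_K aa bx by simp
        then show False using nt aa st unfolding state_def by blast
      qed
    qed
  qed (use st in \<open>auto simp: state_def\<close>)
  moreover have "extends A P (insert y A) (insert (a, a + y) P)"
    using fst by (auto simp: extends_def)
  ultimately show ?thesis using new by blast
qed

lemma state_add_commitments:
  assumes st: "state A P" and T: "finite T" "T \<subseteq> fst ` P"
  shows "\<exists>A' P'. state A' P' \<and> extends A P A' P' \<and> (\<forall>a\<in>T. \<exists>x. (a, x) \<in> P' - P)"
  using T
proof (induction T rule: finite_induct)
  case empty
  then show ?case using st extends_refl by blast
next
  case (insert a T)
  then obtain A1 P1 where 1: "state A1 P1" "extends A P A1 P1" "\<forall>a\<in>T. \<exists>x. (a, x) \<in> P1 - P" by auto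
  have "a \<in> fst ` P1" using insert.prems 1(2) unfolding extends_def by blast
  then obtain A2 P2 where 2: "state A2 P2" "extends A1 P1 A2 P2" "\<exists>x. (a, x) \<in> P2 - P1"
    using state_add_commitment[OF 1(1)] by blast
  have "P \<subseteq> P1" "P1 \<subseteq> P2" using 1 2 by (auto simp: extends_def)
  then have "\<forall>b\<in>insert a T. \<exists>x. (b, x) \<in> P2 - P" using 1(3) 2(3) by blast
  then show ?case using 2 extends_trans[OF 1(2) 2(2)] by blast
qed

text \<open>The non-special summand \<open>b\<close> is later moved inside its coset of
  \<open>K\<close>, turning the congruence into an equality.\<close>

definition covers :: "'a set \<Rightarrow> ('a \<times> 'a) set \<Rightarrow> 'a \<Rightarrow> bool" where
  "covers A P g \<longleftrightarrow> (\<exists>M b. size M = h \<and> set_mset M \<subseteq> A \<and> b \<in># M \<and> b \<notin> fst ` P \<and> sum_mset M - g \<in> K)"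

text \<open>Unless \<open>g\<close> is already committed, it is made a sum of exactly \<open>h\<close> generic elements: a sum of at most \<open>h\<close> terms that does not
  depend on the generic choice must then use each of them once, and equals \<open>g\<close>, or none of them.\<close>

lemma state_cover:
  assumes st: "state A P"
  shows "\<exists>A' P'. state A' P' \<and> extends A P A' P' \<and> covers A' P' g"
proof (cases "\<exists>x\<in>snd ` P. x - g \<in> K")
  case True
  then obtain a x where ax: "(a, x) \<in> P" "x - g \<in> K" by auto
  then obtain y where y: "y \<in> A - fst ` P" "x = a + y" using stateD(3)[OF st] by blast
  have a: "a \<in> A" "0 \<in> A" using ax st by (auto simp: state_def)
  have sum0: "sum_mset (replicate_mset n (0::'a)) = 0" for n by (induction n) auto
  \<comment> \<open>A committed \<open>x = a + y\<close> already has the non-special summand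
    \<open>y\<close>; zeros fill up to exactly \<open>h\<close> summands.\<close>
  have "covers A P g" unfolding covers_def
    using ax y a h2 by (intro exI[of _ "{#a, y#} + replicate_mset (h - 2) 0"] exI[of _ y]) (auto simp: sum0 split: if_splits)
  then show ?thesis using st extends_refl by blast
next
  case False
  define k where "k = h - 1"
  have k: "h = Suc k" "k \<ge> 1" using h2 by (auto simp: k_def)
  \<comment> \<open>\<open>A\<close> is included to keep \<open>b 0\<close> out of the old set; the
    other points are the constants occurring in a violated commitment.\<close>
  define F where "F = A \<union> (\<lambda>(x,s,m). x - s - m \<cdot> g) ` (snd ` P \<times> msums h A \<times> {..h})"
  have fin: "finite A" "finite P" using st by (simp_all add: state_def)
  then have "finite F" unfolding F_def
    by (intro finite_UnI finite_imageI finite_cartesian_product finite_msums) simp_all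
  then obtain b where b: "\<And>n m c j z. c \<in> F \<Longrightarrow> (\<And>j. j < k \<Longrightarrow> n j \<le> h) \<Longrightarrow> m \<le> h \<Longrightarrow>
    (\<Sum>j<k. n j \<cdot> b j) - m \<cdot> (\<Sum>j<k. b j) - c \<in> K \<Longrightarrow> j < k \<Longrightarrow> n j \<cdot> z - m \<cdot> z \<in> K"
    using exists_fresh_family[of F k] by blast
  \<comment> \<open>The last summand completes the generic ones to the sum \<open>g\<close>.\<close>
  define b' where "b' = b(k := g - (\<Sum>j<k. b j))"
  define A' where "A' = A \<union> b' ` {..<h}"
  have lin: "(\<Sum>j<h. n j \<cdot> b' j) = (\<Sum>j<k. n j \<cdot> b j) - n k \<cdot> (\<Sum>j<k. b j) + n k \<cdot> g" for n
    by (simp add: k(1) b'_def nmult_diff algebra_simps)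
  have avoid: "s - x \<notin> K" if ax: "(a, x) \<in> P" and s: "s \<in> msums h (A' - {a})" for a x s
  proof
    assume in_K: "s - x \<in> K"
    have "s \<in> msums h ((A - {a}) \<union> b' ` {..<h})"
      using s msums_mono[of "A' - {a}" "(A - {a}) \<union> b' ` {..<h}"] unfolding A'_def by blast
    then obtain M n where Mn: "set_mset M \<subseteq> A - {a}" "size M + (\<Sum>j<h. n j) \<le> h"
      "s = sum_mset M + (\<Sum>j<h. n j \<cdot> b' j)" by (rule msums_Un_imageE)
    have Msums: "sum_mset M \<in> msums h (A - {a})" unfolding msums_def using Mn by auto
    then have Msums': "sum_mset M \<in> msums h A" using msums_mono[of "A - {a}" A] by blast
    have nle: "n j \<le> h" if "j < h" for j
      using member_le_sum[of j "{..<h}" n] that Mn(2) by simp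
    have xF: "x - sum_mset M - n k \<cdot> g \<in> F"
      unfolding F_def using ax Msums' nle[of k] k
      by (intro UnI2 image_eqI[of _ _ "(x, sum_mset M, n k)"]) force+
    have "(\<Sum>j<k. n j \<cdot> b j) - n k \<cdot> (\<Sum>j<k. b j) - (x - sum_mset M - n k \<cdot> g) = s - x"
      using Mn(3) lin[of n] by (simp add: algebra_simps)
    then have in_K': "(\<Sum>j<k. n j \<cdot> b j) - n k \<cdot> (\<Sum>j<k. b j) - (x - sum_mset M - n k \<cdot> g) \<in> K"
      using in_K by (simp only:)
    \<comment> \<open>All multiplicities act like \<open>n k\<close> on the quotient, so the generic
      part cancels and only \<open>n k \<cdot> g\<close> remains.\<close>
    have same: "n j \<cdot> z - n k \<cdot> z \<in> K" if "j < k" for j z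
      using b[OF xF _ _ in_K' that] nle k by simp
    have "(\<Sum>j<k. n j \<cdot> b j - n k \<cdot> b j) \<in> K" using same by (intro K_sum) simp
    then have "(\<Sum>j<k. n j \<cdot> b j) - n k \<cdot> (\<Sum>j<k. b j) \<in> K"
      by (simp add: sum_subtractf nmult_sum)
    then have "(s - x) - (sum_mset M + n k \<cdot> g - x) \<in> K"
      unfolding Mn(3) lin by (simp add: algebra_simps)
    then have rest: "sum_mset M + n k \<cdot> g - x \<in> K" using in_K K_cong by blast
    show False
    proof (cases "\<forall>z. n k \<cdot> z \<in> K")
      case True
      then have "(sum_mset M + n k \<cdot> g - x) - (sum_mset M - x) \<in> K" by simp
      then have "sum_mset M - x \<in> K" using rest K_cong by blast
      then show False using Msums st ax unfolding state_def by blast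
    next
      case nonzero: False
      then obtain z where z: "n k \<cdot> z \<notin> K" by blast
      have "n j \<ge> 1" if "j < h" for j
      proof (cases "j = k")
        case False
        have "n j \<noteq> 0"
        proof
          assume "n j = 0"
          then have "- (n k \<cdot> z) \<in> K" using same[of j z] False that k by simp
          then have "- (- (n k \<cdot> z)) \<in> K" by (rule K_minus)
          then show False using z by simp
        qed
        then show ?thesis by simp
      next
        case True
        have "n k \<noteq> 0" using z K_zero by (metis nmult.simps(1))
        then show ?thesis using True by simp
      qed
      \<comment> \<open>With \<open>h\<close> positive multiplicities the bound on the number of
        summands is exhausted, so no old summand is left and \<open>n k = 1\<close>.\<close>
      then have ge: "(\<Sum>j<k. n j) \<ge> k" "n k \<ge> 1"
        using sum_mono[of "{..<k}" "\<lambda>_. 1" n] k by simp_all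
      have "(\<Sum>j<h. n j) = (\<Sum>j<k. n j) + n k" by (simp add: k(1))
      then have "size M = 0" "n k = 1" using ge Mn(2) k by linarith+
      then have "g - x \<in> K" using rest by simp
      then have "- (g - x) \<in> K" by (rule K_minus)
      then show False using False ax by force
    qed
  qed
  have st': "state A' P"
    unfolding state_def
  proof (intro conjI allI impI)
    fix a x assume ax: "(a, x) \<in> P"
    show "\<forall>s\<in>msums h (A' - {a}). s - x \<notin> K" using avoid[OF ax] by blast
    show "a \<in> A'" "(a, a) \<in> P" "\<exists>y\<in>A' - fst ` P. x = a + y"
      using ax st unfolding state_def A'_def by blast+
  qed (use st in \<open>auto simp: state_def A'_def\<close>)
  \<comment> \<open>As \<open>k \<ge> 1\<close>, index \<open>0\<close> belongs to a generic summand
    and not to the completing one; it supplies the non-special witness.\<close>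
  have b0: "b 0 \<notin> A"
  proof
    assume "b 0 \<in> A"
    define n :: "nat \<Rightarrow> nat" where "n j = (if j = 0 then 1 else 0)" for j
    have "(\<Sum>j<k. n j \<cdot> b j) = (\<Sum>j<k. if j = 0 then b j else 0)"
      by (intro sum.cong) (auto simp: n_def)
    also have "\<dots> = b 0" using k by simp
    finally have "(\<Sum>j<k. n j \<cdot> b j) - 0 \<cdot> (\<Sum>j<k. b j) - b 0 \<in> K" using K_zero by simp
    then have "n 0 \<cdot> z - 0 \<cdot> z \<in> K" for z
      by (rule b[rotated 3]) (use k h2 \<open>b 0 \<in> A\<close> in \<open>auto simp: n_def F_def\<close>)
    then show False using exists_notin_K by (simp add: n_def)
  qed
  have "fst ` P \<subseteq> A" using st by (auto simp: state_def)
  then have b0': "b' 0 \<notin> fst ` P" using b0 k by (auto simp: b'_def)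
  define M where "M = image_mset b' (mset_set {..<h})"
  have "sum_mset M = (\<Sum>j<h. 1 \<cdot> b' j)" by (simp add: M_def sum_unfold_sum_mset)
  also have "\<dots> = g" by (subst lin) simp
  finally have "sum_mset M - g \<in> K" using K_zero by simp
  moreover have "b' 0 \<in># M" using h2 by (auto simp: M_def)
  moreover have "set_mset M \<subseteq> A'" "size M = h" by (auto simp: M_def A'_def)
  ultimately have "covers A' P g" unfolding covers_def using b0' by blast
  moreover have "extends A P A' P" by (auto simp: extends_def A'_def)
  ultimately show ?thesis using st' by blast
qed

lemma state_step:
  assumes "state A P"
  shows "\<exists>A' P'. state A' P' \<and> extends A P A' P' \<and> covers A' P' g \<and> \<not> fst ` P' \<subseteq> fst ` P \<and>
    (\<forall>a\<in>fst ` P. \<exists>x. (a, x) \<in> P' - P)"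
proof -
  have fin: "finite (fst ` P)" using assms by (simp add: state_def)
  obtain A1 P1 where 1: "state A1 P1" "extends A P A1 P1" "\<forall>a\<in>fst ` P. \<exists>x. (a, x) \<in> P1 - P"
    using state_add_commitments[OF assms fin order.refl] by blast
  obtain A2 P2 where 2: "state A2 P2" "extends A1 P1 A2 P2" "\<not> fst ` P2 \<subseteq> fst ` P1"
    using state_add_special[OF 1(1)] by blast
  obtain A3 P3 where 3: "state A3 P3" "extends A2 P2 A3 P3" "covers A3 P3 g"
    using state_cover[OF 2(1)] by blast
  have P: "P \<subseteq> P1" "P1 \<subseteq> P2" "P2 \<subseteq> P3" using 1 2 3 by (auto simp: extends_def)
  have "\<not> fst ` P3 \<subseteq> fst ` P" using 2(3) P by blast
  moreover have "\<forall>a\<in>fst ` P. \<exists>x. (a, x) \<in> P3 - P" using 1(3) P by blast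
  moreover have "extends A P A3 P3" by (rule extends_trans[OF extends_trans[OF 1(2) 2(2)] 3(2)])
  ultimately show ?thesis using 3 by blast
qed

section \<open>Passage to the limit of the stages\<close>

text \<open>The stages represent every class. Full cosets of the non-special elements turn this into
  equality, while the commitments, being modulo \<open>K\<close>, survive the enlargement.\<close>

lemma exists_basis_with_essential_elements:
  assumes "countable_mod K UNIV"
  shows "\<exists>(A :: 'a set) S. infinite S \<and> S \<subseteq> A \<and> nsumset h A = UNIV \<and>
    (\<forall>a\<in>S. \<exists>X. infinite X \<and> (\<forall>x\<in>X. \<forall>k\<le>h. x \<notin> nsumset k (A - {a})))"
proof -
  obtain R where R: "countable R" "\<And>g. \<exists>r\<in>R. g - r \<in> K"
    using assms unfolding countable_mod_def by auto
  then have "R \<noteq> {}" by auto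
  then have range: "range (from_nat_into R) = R" using R(1) by (rule range_from_nat_into)
  \<comment> \<open>Enumerates representatives of all cosets of \<open>K\<close>; step
    \<open>n\<close> covers the class of \<open>e n\<close>.\<close>
  define e where "e = from_nat_into R"
  have "\<exists>f. \<forall>n. state (fst (f n)) (snd (f n)) \<and>
    (extends (fst (f n)) (snd (f n)) (fst (f (Suc n))) (snd (f (Suc n))) \<and>
     covers (fst (f (Suc n))) (snd (f (Suc n))) (e n) \<and>
     \<not> fst ` snd (f (Suc n)) \<subseteq> fst ` snd (f n) \<and>
     (\<forall>a\<in>fst ` snd (f n). \<exists>x. (a, x) \<in> snd (f (Suc n)) - snd (f n)))"
  proof (rule dependent_nat_choice[where P = "\<lambda>_ s. state (fst s) (snd s)"])
    have "state {0} {}" by (simp add: state_def)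
    then show "\<exists>s. state (fst s) (snd s)" by (intro exI[of _ "({0}, {})"]) simp
    fix s n assume "state (fst s) (snd s)"
    from state_step[OF this, of "e n"]
    show "\<exists>t. state (fst t) (snd t) \<and> extends (fst s) (snd s) (fst t) (snd t) \<and>
      covers (fst t) (snd t) (e n) \<and> \<not> fst ` snd t \<subseteq> fst ` snd s \<and>
      (\<forall>a\<in>fst ` snd s. \<exists>x. (a, x) \<in> snd t - snd s)"
      by (metis fst_conv snd_conv)
  qed
  then obtain f where f: "\<forall>n. state (fst (f n)) (snd (f n)) \<and>
    (extends (fst (f n)) (snd (f n)) (fst (f (Suc n))) (snd (f (Suc n))) \<and>
     covers (fst (f (Suc n))) (snd (f (Suc n))) (e n) \<and>
     \<not> fst ` snd (f (Suc n)) \<subseteq> fst ` snd (f n) \<and>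
     (\<forall>a\<in>fst ` snd (f n). \<exists>x. (a, x) \<in> snd (f (Suc n)) - snd (f n)))" ..
  define A where "A n = fst (f n)" for n
  define P where "P n = snd (f n)" for n
  have st: "\<And>n. state (A n) (P n)"
    and ext1: "\<And>n. extends (A n) (P n) (A (Suc n)) (P (Suc n))"
    and cov: "\<And>n. covers (A (Suc n)) (P (Suc n)) (e n)"
    and special: "\<And>n. \<not> fst ` P (Suc n) \<subseteq> fst ` P n"
    and commit: "\<And>n a. a \<in> fst ` P n \<Longrightarrow> \<exists>x. (a, x) \<in> P (Suc n) - P n"
    using f by (simp_all add: A_def P_def del: ball_simps bex_simps Diff_iff)
  have ext: "extends (A m) (P m) (A n) (P n)" if "m \<le> n" for m n
    using that
  proof (induction n rule: dec_induct)
    case base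
    show ?case by (rule extends_refl)
  next
    case (step n)
    show ?case by (rule extends_trans[OF step.IH ext1])
  qed
  then have Amono: "A m \<subseteq> A n" and Pmono: "P m \<subseteq> P n"
    and old: "fst ` P n \<inter> A m \<subseteq> fst ` P m" if "m \<le> n" for m n
    using that by (simp_all add: extends_def)
  define S where "S = (\<Union>n. fst ` P n)"
  define U where "U = (\<Union>n. A n)"
  have SU: "S \<subseteq> U" unfolding S_def U_def using stateD(1)[OF st] by fastforce
  have nonspecial: "b \<notin> S" if b: "b \<in> A m" "b \<notin> fst ` P m" for b m
  proof
    assume "b \<in> S"
    then obtain n where n: "b \<in> fst ` P n" unfolding S_def by blast
    show False
    proof (cases "m \<le> n")
      case True
      then show ?thesis using old[OF True] n b by blast
    next
      case False
      then show ?thesis using Pmono[of n m] n b by auto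
    qed
  qed
  define B where "B = S \<union> {g. \<exists>b\<in>U - S. g - b \<in> K}"
  have UB: "U \<subseteq> B"
  proof
    fix u assume "u \<in> U"
    moreover have "u - u \<in> K" using K_zero by simp
    ultimately show "u \<in> B" unfolding B_def by blast
  qed
  have "infinite S"
    unfolding S_def by (rule infinite_UN_increasing[where N = 0]) (simp_all add: image_mono Pmono special)
  moreover have "nsumset h B = UNIV"
  proof -
    have "g \<in> nsumset h B" for g
    proof -
      obtain r where r: "r \<in> R" "g - r \<in> K" using R(2) by blast
      then obtain n where n: "r = e n" using range unfolding e_def by blast
      obtain M b where M: "size M = h" "set_mset M \<subseteq> A (Suc n)" "b \<in># M" "b \<notin> fst ` P (Suc n)"
        "sum_mset M - r \<in> K" using cov[of n] unfolding covers_def n by blast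
      obtain N where N: "M = add_mset b N" using M(3) by (metis insert_DiffM)
      \<comment> \<open>Absorbs the error, which lies in \<open>K\<close>, into the non-special
        summand.\<close>
      define b' where "b' = b + (g - sum_mset M)"
      have "(g - r) - (sum_mset M - r) \<in> K" by (rule K_diff[OF r(2) M(5)])
      then have "b' - b \<in> K" by (simp add: b'_def)
      moreover have "b \<in> U - S" using nonspecial[of b "Suc n"] M unfolding U_def by blast
      ultimately have "b' \<in> B" unfolding B_def by blast
      moreover have "set_mset N \<subseteq> B" using M(2) N UB unfolding U_def by auto
      moreover have "g = sum_mset (add_mset b' N)" by (simp add: b'_def N)
      moreover have "size (add_mset b' N) = h" using M(1) N by simp
      ultimately show ?thesis unfolding mem_nsumset_iff
        by (intro exI[of _ "add_mset b' N"]) simp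
    qed
    then show ?thesis by blast
  qed
  moreover have "\<exists>X. infinite X \<and> (\<forall>x\<in>X. \<forall>k\<le>h. x \<notin> nsumset k (B - {a}))" if a: "a \<in> S" for a
  proof -
    \<comment> \<open>From stage \<open>N\<close> on, \<open>a\<close> is special and every step
      adds a commitment for it.\<close>
    obtain N where N: "a \<in> fst ` P N" using a unfolding S_def by blast
    define X where "X n = {x. (a, x) \<in> P n}" for n
    have "infinite (\<Union>n. X n)"
    proof (rule infinite_UN_increasing[where N = N])
      show "X n \<subseteq> X (Suc n)" for n unfolding X_def using Pmono[of n "Suc n"] by auto
      show "\<not> X (Suc n) \<subseteq> X n" if "N \<le> n" for n
        using commit[of a n] Pmono[OF that] N unfolding X_def by blast
    qed
    moreover have "x \<notin> nsumset k (B - {a})" if x: "x \<in> (\<Union>n. X n)" and k: "k \<le> h" for x k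
    proof
      assume "x \<in> nsumset k (B - {a})"
      then obtain M where M: "size M = k" "set_mset M \<subseteq> B - {a}" "x = sum_mset M"
        unfolding mem_nsumset_iff by blast
      \<comment> \<open>Each summand is replaced by a congruent element of some stage. One taken
        from a coset goes to a non-special element, which cannot be \<open>a\<close>.\<close>
      have "\<exists>n N. size N = size M \<and> set_mset N \<subseteq> A n - {a} \<and> sum_mset N - sum_mset M \<in> K"
        using M(2)
      proof (induction M)
        case empty
        show ?case by (intro exI[of _ 0] exI[of _ "{#}"]) (simp add: K_zero)
      next
        case (add g M)
        then obtain n N where nN: "size N = size M" "set_mset N \<subseteq> A n - {a}" "sum_mset N - sum_mset M \<in> K"
          by auto
        have "g \<in> B - {a}" using add.prems by simp
        then obtain u where u: "u \<in> U" "u \<noteq> a" "u - g \<in> K"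
        proof (cases "g \<in> S")
          case True
          then show ?thesis using that[of g] \<open>g \<in> B - {a}\<close> SU K_zero by auto
        next
          case False
          then obtain u where u: "u \<in> U - S" "g - u \<in> K" using \<open>g \<in> B - {a}\<close> unfolding B_def by blast
          have "u - g \<in> K" using K_minus[OF u(2)] by simp
          then show ?thesis using that[of u] u(1) a by blast
        qed
        then obtain m where m: "u \<in> A m" unfolding U_def by blast
        have "set_mset (add_mset u N) \<subseteq> A (max m n) - {a}"
          using nN(2) m u(2) Amono[of n "max m n"] Amono[of m "max m n"] by auto
        moreover have "sum_mset (add_mset u N) - sum_mset (add_mset g M) \<in> K"
          using K_add[OF u(3) nN(3)] by (simp add: algebra_simps)
        ultimately show ?case using nN(1)
          by (intro exI[of _ "max m n"] exI[of _ "add_mset u N"]) simp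
      qed
      then obtain n N where nN: "size N = k" "set_mset N \<subseteq> A n - {a}" "sum_mset N - x \<in> K"
        using M by auto
      obtain m where m: "(a, x) \<in> P m" using x unfolding X_def by blast
      have ax: "(a, x) \<in> P (max m n)" using m Pmono[of m "max m n"] by auto
      have "set_mset N \<subseteq> A (max m n) - {a}" using nN(2) Amono[of n "max m n"] by auto
      then have "sum_mset N \<in> msums h (A (max m n) - {a})"
        unfolding msums_def using nN(1) k by blast
      then show False using stateD(4)[OF st ax] nN(3) by blast
    qed
    ultimately show ?thesis by blast
  qed
  moreover have "S \<subseteq> B" using SU UB by (rule order.trans)
  ultimately show ?thesis by (intro exI[of _ B] exI[of _ S]) blast
qed

end

section \<open>Combination of the two bounds\<close>

theorem theorem1p7:
  fixes h :: nat
  assumes "infinite (UNIV :: 'a::ab_group_add set)"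
    and "h \<ge> 2"
  shows "enat (h + 1) \<le> S_fun TYPE('a) h \<and> S_fun TYPE('a) h \<le> enat (2 * h)"
proof
  show "S_fun TYPE('a) h \<le> enat (2 * h)"
    unfolding S_fun_def using finite_large_ord_star[OF assms(1)] assms(2) by (intro Inf_lower) auto
next
  obtain K :: "'a set" where K: "add_subgroup K" "infinite_index K" "countable_mod K UNIV"
    "\<forall>m\<le>h. (\<forall>z. m \<cdot> z \<in> K) \<or> infinite_index {z. m \<cdot> z \<in> K}"
    using exists_good_quotient[OF assms(1)] by blast
  interpret good_quotient K h by unfold_locales (use K assms in auto)
  obtain A S :: "'a set" where A: "infinite S" "S \<subseteq> A" "nsumset h A = UNIV"
    and ess: "\<And>a. a \<in> S \<Longrightarrow> \<exists>X. infinite X \<and> (\<forall>x\<in>X. \<forall>k\<le>h. x \<notin> nsumset k (A - {a}))"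
    using exists_basis_with_essential_elements[OF K(3)] by blast
  have ord: "ord_star (A - {a}) \<ge> enat (h + 1)" if a: "a \<in> S" for a
    unfolding ord_star_def
  proof (rule Inf_greatest)
    fix y assume "y \<in> {enat k |k. 1 \<le> k \<and> nsumset k (A - {a}) \<sim>\<^sup>* UNIV}"
    then obtain k where k: "y = enat k" "finite (- nsumset k (A - {a}))"
      by (auto simp: almost_eq_def Compl_eq_Diff_UNIV)
    obtain X where X: "infinite X" "\<forall>x\<in>X. \<forall>k\<le>h. x \<notin> nsumset k (A - {a})" using ess[OF a] by blast
    have "\<not> k \<le> h"
    proof
      assume "k \<le> h"
      then have "X \<subseteq> - nsumset k (A - {a})" using X(2) by blast
      then show False using X(1) k(2) finite_subset by blast
    qed
    then show "enat (h + 1) \<le> y" using k(1) by simp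
  qed
  show "enat (h + 1) \<le> S_fun TYPE('a) h"
    unfolding S_fun_def
  proof (rule Inf_greatest)
    fix y assume "y \<in> {enat s |s. \<forall>A :: 'a set. nsumset h A \<sim>\<^sup>* UNIV \<longrightarrow>
      finite {a \<in> A. ord_star (A - {a}) > enat s}}"
    then obtain s where s: "y = enat s" "finite {a \<in> A. ord_star (A - {a}) > enat s}"
      using A(3) by (auto simp: almost_eq_def)
    \<comment> \<open>Orders of at least \<open>h + 1\<close> exceed every \<open>s \<le> h\<close>,
      so all of the infinite set \<open>S\<close> would be exceptional for such an
      \<open>s\<close>.\<close>
    have "\<not> s \<le> h"
    proof
      assume "s \<le> h"
      then have "enat s < enat (h + 1)" by simp
      then have "enat s < ord_star (A - {a})" if "a \<in> S" for a
        using ord[OF that] by (rule less_le_trans)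
      then have "S \<subseteq> {a \<in> A. ord_star (A - {a}) > enat s}" using A(2) by auto
      then show False using A(1) s(2) finite_subset by blast
    qed
    then show "enat (h + 1) \<le> y" using s(1) by simp
  qed
qed

end
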